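(* Let $M$ be a complex manifold. Then the core $\mathbf{c}(M)$ is the disjoint union of sets $E_j$, $j\in J$, that are 1-pseudoconcave in the sense of Rothstein and have the following Liouville property: every function from $PSH^{cb}(M)$ is constant on each of the sets $E_j$.
   Context: $PSH^{cb}(M)$ is the space of bounded continuous plurisubharmonic functions on $M$. The core $\mathbf{c}(M)$ is the set of all points $w\in M$ such that every function of $PSH^{cb}(M)$ fails to be smooth and strictly plurisubharmonic near $w$ (i.e. no function of $PSH^{cb}(M)$ is smooth and strictly plurisubharmonic on a neighborhood of $w$). A closed set $E\subset M$ is called 1-pseudoconcave in the sense of Rothstein if for any $z_0\in E$, any (smooth) strictly plurisubharmonic function $\rho$ defined on a neighborhood $V$ of $z_0$, and any neighborhood $U\subset\subset V$ of $z_0$, there is a point $z\in E\cap U$ with $\rho(z)>\rho(z_0)$. *)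

theory Defs
  imports "HOL-Analysis.Analysis" "HOL-Library.Disjoint_Sets"
begin

subsection \<open>Complex manifolds\<close>

definition holomorphic_map_on ::
    "(complex ^ 'n \<Rightarrow> complex ^ 'm) \<Rightarrow> (complex ^ 'n) set \<Rightarrow> bool" where
  "holomorphic_map_on f S \<longleftrightarrow>
     (\<forall>z\<in>S. \<exists>D. (f has_derivative D) (at z) \<and> (\<forall>c v. D (c *s v) = c *s D v))"

text \<open>
  A chart is a pair of an open domain and a map that is only relevant on that domain. Its inverse
  is \<open>inv_into U \<phi>\<close>.
\<close>

type_synonym ('a, 'n) chart = "'a set \<times> ('a \<Rightarrow> complex ^ 'n)"

definition is_chart :: "('a::topological_space, 'n::finite) chart \<Rightarrow> bool" where
  "is_chart = (\<lambda>(U, \<phi>). open U \<and> open (\<phi> ` U) \<and> homeomorphism U (\<phi> ` U) \<phi> (inv_into U \<phi>))"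

text \<open>
  The manifold is the whole type \<open>'a\<close>, of complex dimension \<open>CARD('n)\<close>. The atlas need not be
  maximal, and the manifold need not be connected.
\<close>

locale complex_manifold =
  fixes atlas :: "('a::{t2_space, second_countable_topology}, 'n::finite) chart set"
  assumes charts: "c \<in> atlas \<Longrightarrow> is_chart c"
    and covering: "(\<Union>(U, \<phi>)\<in>atlas. U) = UNIV"
    and holomorphic_transition:
      "(U, \<phi>) \<in> atlas \<Longrightarrow> (V, \<psi>) \<in> atlas \<Longrightarrow>
         holomorphic_map_on (\<psi> \<circ> inv_into U \<phi>) (\<phi> ` (U \<inter> V))"


subsection \<open>Smooth functions and the Levi form on open subsets of complex Euclidean space\<close>

fun Ck_on :: "nat \<Rightarrow> 'a::real_normed_vector set \<Rightarrow> ('a \<Rightarrow> 'b::real_normed_vector) \<Rightarrow> bool" where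
  "Ck_on 0 S f \<longleftrightarrow> continuous_on S f"
| "Ck_on (Suc k) S f \<longleftrightarrow>
     (\<forall>x\<in>S. f differentiable (at x)) \<and> (\<forall>v. Ck_on k S (\<lambda>x. frechet_derivative f (at x) v))"

definition smooth_on :: "'a::real_normed_vector set \<Rightarrow> ('a \<Rightarrow> 'b::real_normed_vector) \<Rightarrow> bool" where
  "smooth_on S f \<longleftrightarrow> (\<forall>k. Ck_on k S f)"

definition wirtinger :: "'n \<Rightarrow> (complex ^ 'n \<Rightarrow> complex) \<Rightarrow> complex ^ 'n \<Rightarrow> complex" where
  "wirtinger j f z =
     (frechet_derivative f (at z) (axis j 1) - \<i> * frechet_derivative f (at z) (axis j \<i>)) / 2"

definition wirtinger_bar :: "'n \<Rightarrow> (complex ^ 'n \<Rightarrow> complex) \<Rightarrow> complex ^ 'n \<Rightarrow> complex" where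
  "wirtinger_bar j f z =
     (frechet_derivative f (at z) (axis j 1) + \<i> * frechet_derivative f (at z) (axis j \<i>)) / 2"

definition levi_form :: "(complex ^ 'n \<Rightarrow> real) \<Rightarrow> complex ^ 'n \<Rightarrow> complex ^ 'n \<Rightarrow> complex" where
  "levi_form u z v =
     (\<Sum>j\<in>UNIV. \<Sum>k\<in>UNIV.
        wirtinger j (wirtinger_bar k (\<lambda>w. complex_of_real (u w))) z * v $ j * cnj (v $ k))"

text \<open>
  The complex Hessian of a smooth real function is Hermitian, so its Levi form is real and
  taking its real part loses nothing.
\<close>

definition smooth_strictly_psh_on :: "(complex ^ 'n) set \<Rightarrow> (complex ^ 'n \<Rightarrow> real) \<Rightarrow> bool" where
  "smooth_strictly_psh_on S u \<longleftrightarrow>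
     smooth_on S u \<and> (\<forall>z\<in>S. \<forall>v. v \<noteq> 0 \<longrightarrow> Re (levi_form u z v) > 0)"


subsection \<open>Plurisubharmonic functions\<close>

text \<open>
  Real-valued plurisubharmonic functions on an open set: upper semicontinuous functions satisfying
  the sub-mean value inequality on every closed affine complex disc in the set. Since such a
  function is bounded above on each circle and finite at the centre, its circle averages are
  automatically finite; integrability is listed because the integral of a non-integrable function
  is a dummy value.
\<close>

definition psh_on :: "(complex ^ 'n) set \<Rightarrow> (complex ^ 'n \<Rightarrow> real) \<Rightarrow> bool" where
  "psh_on S u \<longleftrightarrow>
     (\<forall>c. openin (top_of_set S) {z \<in> S. u z < c}) \<and>
     (\<forall>z v. (\<forall>\<zeta>. cmod \<zeta> \<le> 1 \<longrightarrow> z + \<zeta> *s v \<in> S) \<longrightarrow>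
        (\<lambda>t. u (z + cis t *s v)) absolutely_integrable_on {0..2 * pi} \<and>
        u z \<le> integral {0..2 * pi} (\<lambda>t. u (z + cis t *s v)) / (2 * pi))"


subsection \<open>The core and Rothstein pseudoconcavity\<close>

context complex_manifold
begin

definition plurisubharmonic :: "('a \<Rightarrow> real) \<Rightarrow> bool" where
  "plurisubharmonic u \<longleftrightarrow> (\<forall>(U, \<phi>)\<in>atlas. psh_on (\<phi> ` U) (u \<circ> inv_into U \<phi>))"

definition smooth_strictly_plurisubharmonic_on :: "'a set \<Rightarrow> ('a \<Rightarrow> real) \<Rightarrow> bool" where
  "smooth_strictly_plurisubharmonic_on W u \<longleftrightarrow>
     (\<forall>(U, \<phi>)\<in>atlas. smooth_strictly_psh_on (\<phi> ` (U \<inter> W)) (u \<circ> inv_into U \<phi>))"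

definition PSH_cb :: "('a \<Rightarrow> real) set" where
  "PSH_cb = {u. plurisubharmonic u \<and> continuous_on UNIV u \<and> bounded (range u)}"

definition core :: "'a set" where
  "core = {w. \<not> (\<exists>u\<in>PSH_cb. \<exists>W. open W \<and> w \<in> W \<and> smooth_strictly_plurisubharmonic_on W u)}"

definition pseudoconcave1 :: "'a set \<Rightarrow> bool" where
  "pseudoconcave1 E \<longleftrightarrow> closed E \<and>
     (\<forall>z0\<in>E. \<forall>V \<rho> U.
        open V \<and> z0 \<in> V \<and> smooth_strictly_plurisubharmonic_on V \<rho> \<and>
        open U \<and> z0 \<in> U \<and> compact (closure U) \<and> closure U \<subseteq> V \<longrightarrow>
        (\<exists>z\<in>E \<inter> U. \<rho> z > \<rho> z0))"

end

end

theory Submission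
  imports Defs "HOL-Complex_Analysis.Cauchy_Integral_Formula"
begin

text \<open>
  Call two points of the manifold equivalent if no function of \<open>PSH_cb\<close> separates them. The sets
  of the partition are the equivalence classes of points of the core, so the Liouville property
  holds by construction, and two things remain.

  A class that meets the core lies in the core (\<open>not_core_separated\<close>). If \<open>u\<close> is smooth and strictly
  plurisubharmonic near \<open>w\<close>, then so is \<open>u + \<delta> (r\<^sup>2 - \<bar>z - w\<bar>\<^sup>2)\<close> for small \<open>\<delta>\<close>, and the maximum
  of the two functions agrees with \<open>u\<close> away from \<open>w\<close> but is larger at \<open>w\<close>. So a point outside the
  core is separated from every other point, and a class is the common level set of all functions of
  \<open>PSH_cb\<close>; in particular it is closed.

  A class \<open>E\<close> is pseudoconcave (\<open>level_class_not_locally_maximal\<close>). Suppose that \<open>\<rho> \<le> \<rho> z0\<close> on \<open>E\<close>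
  near a point \<open>z0\<close> of \<open>E\<close>. After subtraction of \<open>\<delta> \<bar>z - z0\<bar>\<^sup>2\<close> and \<open>\<rho> z0\<close>, the function \<open>\<rho>\<close> is
  strictly plurisubharmonic, vanishes at \<open>z0\<close> and is bounded above by a negative constant on the part
  of \<open>E\<close> in a small annulus about \<open>z0\<close>. The part of the annulus where it exceeds that constant is a
  compact set of points that are separated from \<open>z0\<close>. It may happen that every separating function is
  smaller there than at \<open>z0\<close>, so a positive separating function cannot be taken from \<open>PSH_cb\<close>. It can
  be taken as a difference \<open>a - b\<close> of two functions of \<open>PSH_cb\<close> (\<open>separating_difference\<close>), because
  \<open>\<bar>u - u z0\<bar> = 2 max (u, u z0) - (u + u z0)\<close>. For large \<open>L\<close> and small \<open>s\<close> the function
  \<open>max (L a - s, \<rho> + L b)\<close> equals \<open>L a - s\<close> on the annulus and \<open>\<rho> + L b\<close> near \<open>z0\<close>; extended by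
  \<open>L a - s\<close> it belongs to \<open>PSH_cb\<close>. As \<open>\<rho> + L b\<close> is continuous but perhaps not smooth, \<open>L b\<close> is
  replaced in the chart by a mollification (\<open>psh_mollification\<close>). The result is smooth and
  strictly plurisubharmonic near \<open>z0\<close>, so \<open>z0\<close> is not in the core, a contradiction.

  Two analytic tools carry the gluing. Sub-mean value inequalities on arbitrary discs are obtained
  from the pointwise condition \<open>subh_at\<close> by comparison with harmonic polynomials
  (\<open>submean_of_subh\<close>); the pointwise condition passes from either function to the maximum of two and
  holds for smooth functions with nonnegative Levi form. And smoothness and positivity of
  the Levi form pass from one chart to all charts, since holomorphic maps are smooth and the
  Levi form transforms by their derivative (\<open>line_lap_holomorphic_comp\<close>).
\<close>

section \<open>Calculus of continuously differentiable functions\<close>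

unbundle no fps_syntax

abbreviation fd :: "('a::real_normed_vector \<Rightarrow> 'b::real_normed_vector) \<Rightarrow> 'a \<Rightarrow> 'a \<Rightarrow> 'b"
  where "fd f x v \<equiv> frechet_derivative f (at x) v"

lemma fd_eqI: "(f has_derivative D) (at x) \<Longrightarrow> fd f x v = D v"
  using frechet_derivative_at by metis

lemma fd_cong_open:
  assumes "open S" "x \<in> S" "\<And>y. y \<in> S \<Longrightarrow> f y = g y"
  shows "frechet_derivative f (at x) = frechet_derivative g (at x)"
proof -
  have "(f has_derivative D) (at x) = (g has_derivative D) (at x)" for D
    using assms has_derivative_transform_within_open[of f D x UNIV S g]
      has_derivative_transform_within_open[of g D x UNIV S f] by auto
  then show ?thesis by (simp add: frechet_derivative_def)
qed

lemma differentiable_cong_open: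
  assumes "open S" "x \<in> S" "\<And>y. y \<in> S \<Longrightarrow> f y = g y" "f differentiable (at x)"
  shows "g differentiable (at x)"
  using assms has_derivative_transform_within_open[of f _ x UNIV S g] by (metis differentiable_def)

lemma Ck_on_subset: "Ck_on k T f \<Longrightarrow> S \<subseteq> T \<Longrightarrow> Ck_on k S f"
  by (induction k arbitrary: f) (auto intro: continuous_on_subset)

lemma Ck_on_cong:
  assumes "open S" "\<And>x. x \<in> S \<Longrightarrow> f x = g x" "Ck_on k S f"
  shows "Ck_on k S g"
  using assms(2,3)
proof (induction k arbitrary: f g)
  case 0
  then show ?case using continuous_on_cong by fastforce
next
  case (Suc k)
  have "g differentiable (at x)" if "x \<in> S" for x
    using differentiable_cong_open[OF assms(1) that Suc.prems(1)] Suc.prems(2) that by auto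
  moreover have "Ck_on k S (\<lambda>x. fd g x v)" for v
  proof (rule Suc.IH)
    show "fd f x v = fd g x v" if "x \<in> S" for x
      using fd_cong_open[OF assms(1) that Suc.prems(1)] by simp
    show "Ck_on k S (\<lambda>x. fd f x v)" using Suc.prems(2) by auto
  qed
  ultimately show ?case by auto
qed

lemma Ck_on_SucI:
  assumes "open S" "\<And>x. x \<in> S \<Longrightarrow> (f has_derivative D x) (at x)"
    and "\<And>v. Ck_on k S (\<lambda>x. D x v)"
  shows "Ck_on (Suc k) S f"
proof -
  have "Ck_on k S (\<lambda>x. fd f x v)" for v
    by (rule Ck_on_cong[OF assms(1) _ assms(3)[of v]]) (simp add: fd_eqI[OF assms(2)])
  then show ?thesis using assms(2) by (auto simp: differentiable_def)
qed

lemma Ck_on_SucD: "Ck_on (Suc k) S f \<Longrightarrow> Ck_on k S f"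
proof (induction k arbitrary: f)
  case 0
  then show ?case
    by (auto intro!: continuous_at_imp_continuous_on differentiable_imp_continuous_within)
next
  case (Suc k)
  then have "f differentiable (at x)" if "x \<in> S" for x using that by auto
  moreover have "Ck_on k S (\<lambda>x. fd f x v)" for v
    by (rule Suc.IH) (use Suc.prems in simp)
  ultimately show ?case by simp
qed

lemma Ck_on_has_derivative:
  "Ck_on (Suc k) S f \<Longrightarrow> x \<in> S \<Longrightarrow> (f has_derivative frechet_derivative f (at x)) (at x)"
  by (simp add: frechet_derivative_works)

lemma Ck_on_const: "Ck_on k S (\<lambda>x. c)"
  by (induction k arbitrary: c) (auto simp: fd_eqI[OF has_derivative_const])

lemma Ck_on_linear:
  assumes "bounded_linear f" shows "Ck_on k S f"
proof (cases k)
  case 0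
  then show ?thesis using assms by (simp add: linear_continuous_on)
next
  case (Suc j)
  have "(f has_derivative f) (at x)" for x using assms bounded_linear_imp_has_derivative by blast
  then have "Ck_on (Suc j) UNIV f"
    by (intro Ck_on_SucI[where D="\<lambda>_. f"]) (auto intro: Ck_on_const)
  then show ?thesis using Suc Ck_on_subset by blast
qed

lemma Ck_on_add:
  assumes "open S" "Ck_on k S f" "Ck_on k S g"
  shows "Ck_on k S (\<lambda>x. f x + g x)"
  using assms(2,3)
proof (induction k arbitrary: f g)
  case 0
  then show ?case by (auto intro: continuous_intros)
next
  case (Suc k)
  show ?case
  proof (rule Ck_on_SucI[OF assms(1)])
    show "((\<lambda>x. f x + g x) has_derivative (\<lambda>v. fd f x v + fd g x v)) (at x)" if "x \<in> S" for x
      by (intro has_derivative_add Ck_on_has_derivative[OF Suc.prems(1) that]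
          Ck_on_has_derivative[OF Suc.prems(2) that])
    show "Ck_on k S (\<lambda>x. fd f x v + fd g x v)" for v
      by (rule Suc.IH) (use Suc.prems in auto)
  qed
qed

lemma Ck_on_linear_comp:
  assumes "open S" "bounded_linear L" "Ck_on k S f"
  shows "Ck_on k S (\<lambda>x. L (f x))"
  using assms(3)
proof (induction k arbitrary: f)
  case 0
  then show ?case using assms(2) bounded_linear.continuous_on by fastforce
next
  case (Suc k)
  show ?case
  proof (rule Ck_on_SucI[OF assms(1)])
    show "((\<lambda>x. L (f x)) has_derivative (\<lambda>v. L (fd f x v))) (at x)" if "x \<in> S" for x
      by (intro bounded_linear.has_derivative[OF assms(2)] Ck_on_has_derivative[OF Suc.prems(1) that])
    show "Ck_on k S (\<lambda>x. L (fd f x v))" for v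
      by (rule Suc.IH) (use Suc.prems in auto)
  qed
qed

lemma Ck_on_mult:
  fixes f g :: "'a::real_normed_vector \<Rightarrow> real"
  assumes "open S" "Ck_on k S f" "Ck_on k S g"
  shows "Ck_on k S (\<lambda>x. f x * g x)"
  using assms(2,3)
proof (induction k arbitrary: f g)
  case 0
  then show ?case by (auto intro: continuous_intros)
next
  case (Suc k)
  show ?case
  proof (rule Ck_on_SucI[OF assms(1)])
    show "((\<lambda>x. f x * g x) has_derivative (\<lambda>v. f x * fd g x v + fd f x v * g x)) (at x)"
      if "x \<in> S" for x
      by (intro has_derivative_mult Ck_on_has_derivative[OF Suc.prems(1) that]
          Ck_on_has_derivative[OF Suc.prems(2) that])
    show "Ck_on k S (\<lambda>x. f x * fd g x v + fd f x v * g x)" for v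
    proof (rule Ck_on_add[OF assms(1)])
      show "Ck_on k S (\<lambda>x. f x * fd g x v)"
        by (rule Suc.IH[OF Ck_on_SucD]) (use Suc.prems in auto)
      show "Ck_on k S (\<lambda>x. fd f x v * g x)"
        by (rule Suc.IH[OF _ Ck_on_SucD]) (use Suc.prems in auto)
    qed
  qed
qed

lemma Ck_on_sum:
  assumes "open S" "finite I" "\<And>i. i \<in> I \<Longrightarrow> Ck_on k S (f i)"
  shows "Ck_on k S (\<lambda>x. \<Sum>i\<in>I. f i x)"
  using assms(2,3)
  by (induction I rule: finite_induct) (auto intro: Ck_on_const Ck_on_add[OF assms(1)])

lemma Ck_on_cmult:
  fixes f :: "'a::real_normed_vector \<Rightarrow> real"
  assumes "open S" "Ck_on k S f"
  shows "Ck_on k S (\<lambda>x. c * f x)"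
  by (intro Ck_on_mult Ck_on_const assms)

lemma Ck_on_diff:
  assumes "open S" "Ck_on k S f" "Ck_on k S g"
  shows "Ck_on k S (\<lambda>x. f x - g x)"
  using Ck_on_add[OF assms(1,2) Ck_on_linear_comp[OF assms(1) bounded_linear_minus[OF bounded_linear_ident] assms(3)]]
  by simp

lemma linear_expand:
  fixes f :: "'b::euclidean_space \<Rightarrow> real"
  assumes "linear f" shows "f w = (\<Sum>b\<in>Basis. f b * (w \<bullet> b))"
proof -
  have "f w = f (\<Sum>b\<in>Basis. (w \<bullet> b) *\<^sub>R b)" by (simp add: euclidean_representation)
  also have "\<dots> = (\<Sum>b\<in>Basis. f b * (w \<bullet> b))"
    using assms by (simp add: linear_sum linear_cmul mult.commute)
  finally show ?thesis .
qed

text \<open>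
  The expansion of the derivative of \<open>f\<close> in a basis turns the chain rule into a sum of products of
  scalar functions, so that the induction needs only sums, products and the induction hypothesis.
\<close>
lemma Ck_on_comp:
  fixes f :: "'b::euclidean_space \<Rightarrow> real" and h :: "'a::real_normed_vector \<Rightarrow> 'b"
  assumes "open S" "h ` S \<subseteq> T" "Ck_on k T f" "Ck_on k S h"
  shows "Ck_on k S (\<lambda>x. f (h x))"
  using assms(3,4)
proof (induction k arbitrary: f)
  case 0
  then show ?case using continuous_on_compose2[of T f S h] assms(2) by auto
next
  case (Suc k)
  show ?case
  proof (rule Ck_on_SucI[OF assms(1)])
    fix x assume x: "x \<in> S"
    then have *: "(f has_derivative frechet_derivative f (at (h x))) (at (h x))"
      using Ck_on_has_derivative[OF Suc.prems(1)] assms(2) by blast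
    have "((\<lambda>x. f (h x)) has_derivative (\<lambda>v. fd f (h x) (fd h x v))) (at x)"
      by (rule has_derivative_compose[OF Ck_on_has_derivative[OF Suc.prems(2) x] *])
    moreover have "fd f (h x) (fd h x v) = (\<Sum>b\<in>Basis. fd f (h x) b * (fd h x v \<bullet> b))" for v
      by (intro linear_expand) (use * has_derivative_linear in blast)
    ultimately show "((\<lambda>x. f (h x)) has_derivative
        (\<lambda>v. \<Sum>b\<in>Basis. fd f (h x) b * (fd h x v \<bullet> b))) (at x)" by simp
  next
    fix v
    show "Ck_on k S (\<lambda>x. \<Sum>b\<in>Basis. fd f (h x) b * (fd h x v \<bullet> b))"
    proof (intro Ck_on_sum Ck_on_mult assms(1) finite_Basis)
      fix b
      show "Ck_on k S (\<lambda>x. fd f (h x) b)"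
        using Suc.IH[of "\<lambda>y. fd f y b"] Suc.prems Ck_on_SucD by auto
      show "Ck_on k S (\<lambda>x. fd h x v \<bullet> b)"
        using Suc.prems(2) by (intro Ck_on_linear_comp[OF assms(1) bounded_linear_inner_left]) simp
    qed
  qed
qed

section \<open>Second derivatives and the Levi form\<close>

definition hess :: "('a::real_normed_vector \<Rightarrow> 'b::real_normed_vector) \<Rightarrow> 'a \<Rightarrow> 'a \<Rightarrow> 'a \<Rightarrow> 'b"
  where "hess f x v w = fd (\<lambda>y. fd f y v) x w"

lemma smooth_onD: "smooth_on S f \<Longrightarrow> Ck_on k S f" by (simp add: smooth_on_def)

lemma smooth_has_derivative:
  "smooth_on S f \<Longrightarrow> x \<in> S \<Longrightarrow> (f has_derivative frechet_derivative f (at x)) (at x)"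
  by (meson Ck_on_has_derivative smooth_on_def)

lemma smooth_fd: "smooth_on S f \<Longrightarrow> smooth_on S (\<lambda>x. fd f x v)"
  unfolding smooth_on_def using Ck_on.simps(2) by blast

lemma smooth_hess:
  "smooth_on S f \<Longrightarrow> x \<in> S \<Longrightarrow> ((\<lambda>y. fd f y v) has_derivative hess f x v) (at x)"
  unfolding hess_def using smooth_has_derivative[OF smooth_fd] by blast

lemma smooth_continuous: "smooth_on S f \<Longrightarrow> continuous_on S f"
  using smooth_onD[of S f 0] by simp

lemma continuous_hess: "smooth_on S f \<Longrightarrow> continuous_on S (\<lambda>x. hess f x v w)"
  unfolding hess_def by (intro smooth_continuous smooth_fd)

lemma linear_fd: "smooth_on S f \<Longrightarrow> x \<in> S \<Longrightarrow> linear (frechet_derivative f (at x))"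
  using smooth_has_derivative has_derivative_linear by blast

lemma linear_hess_right: "smooth_on S f \<Longrightarrow> x \<in> S \<Longrightarrow> linear (hess f x v)"
  using smooth_hess has_derivative_linear by blast

lemma hess_eqI:
  assumes "open S" "x \<in> S" "\<And>y. y \<in> S \<Longrightarrow> fd f y v = g y" "(g has_derivative D) (at x)"
  shows "hess f x v w = D w"
proof -
  have "frechet_derivative (\<lambda>y. fd f y v) (at x) = frechet_derivative g (at x)"
    by (rule fd_cong_open) (use assms in auto)
  then show ?thesis unfolding hess_def by (simp add: fd_eqI[OF assms(4)])
qed

lemma linear_hess_left:
  assumes "open S" "smooth_on S f" "x \<in> S" shows "linear (\<lambda>v. hess f x v w)"
proof (rule linearI)
  show "hess f x (v1 + v2) w = hess f x v1 w + hess f x v2 w" for v1 v2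
    by (rule hess_eqI[OF assms(1,3), of _ _ "\<lambda>y. fd f y v1 + fd f y v2"])
      (auto simp: linear_add[OF linear_fd[OF assms(2)]]
        intro!: has_derivative_add smooth_hess[OF assms(2,3)])
  show "hess f x (c *\<^sub>R v) w = c *\<^sub>R hess f x v w" for c v
    by (rule hess_eqI[OF assms(1,3), of _ _ "\<lambda>y. c *\<^sub>R fd f y v"])
      (auto simp: linear_cmul[OF linear_fd[OF assms(2)]]
        intro!: has_derivative_scaleR_right smooth_hess[OF assms(2,3)])
qed

lemma hess_add:
  assumes "open S" "smooth_on S f" "smooth_on S g" "x \<in> S"
  shows "hess (\<lambda>x. f x + g x) x v w = hess f x v w + hess g x v w"
proof (rule hess_eqI[OF assms(1,4), of _ _ "\<lambda>y. fd f y v + fd g y v"])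
  show "fd (\<lambda>x. f x + g x) y v = fd f y v + fd g y v" if "y \<in> S" for y
    by (rule fd_eqI, rule has_derivative_add) (use smooth_has_derivative assms that in blast)+
qed (intro has_derivative_add smooth_hess[OF assms(2,4)] smooth_hess[OF assms(3,4)])

lemma hess_cmult:
  fixes f :: "'a::real_normed_vector \<Rightarrow> real"
  assumes "open S" "smooth_on S f" "x \<in> S"
  shows "hess (\<lambda>x. c * f x) x v w = c * hess f x v w"
proof (rule hess_eqI[OF assms(1,3), of _ _ "\<lambda>y. c * fd f y v"])
  show "fd (\<lambda>x. c * f x) y v = c * fd f y v" if "y \<in> S" for y
    by (rule fd_eqI, rule has_derivative_mult_right) (use smooth_has_derivative assms that in blast)+
qed (intro has_derivative_mult_right smooth_hess[OF assms(2,3)])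

lemma hess_cong:
  assumes "open S" "\<And>y. y \<in> S \<Longrightarrow> f y = g y" "x \<in> S"
  shows "hess f x v w = hess g x v w"
proof -
  have "fd f y v = fd g y v" if "y \<in> S" for y
    using fd_cong_open[OF assms(1) that assms(2)] by simp
  then show ?thesis unfolding hess_def
    using fd_cong_open[OF assms(1,3), of "\<lambda>y. fd f y v" "\<lambda>y. fd g y v"] by simp
qed

text \<open>
  The Laplacian at \<open>0\<close> of \<open>\<zeta> \<mapsto> f (z + \<zeta> v)\<close>, which is four times the Levi form. Unlike the Levi
  form it is expressed by two second derivatives along real lines.
\<close>
definition line_lap :: "(complex ^ 'n::finite \<Rightarrow> real) \<Rightarrow> complex ^ 'n \<Rightarrow> complex ^ 'n \<Rightarrow> real" where
  "line_lap f z v = hess f z v v + hess f z (\<i> *s v) (\<i> *s v)"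

lemma vec_basis_expand:
  fixes v :: "complex ^ 'n::finite"
  shows "v = (\<Sum>j\<in>UNIV. Re (v $ j) *\<^sub>R axis j 1 + Im (v $ j) *\<^sub>R axis j \<i>)"
proof -
  have "(\<Sum>j\<in>UNIV. Re (v $ j) *\<^sub>R axis j 1 + Im (v $ j) *\<^sub>R axis j \<i>) $ i = v $ i" for i
  proof -
    have "(\<Sum>j\<in>UNIV. Re (v $ j) *\<^sub>R axis j 1 + Im (v $ j) *\<^sub>R axis j \<i>) $ i =
      (\<Sum>j\<in>UNIV. if i = j then v $ i else 0)"
      unfolding sum_component
      by (rule sum.cong) (auto simp: axis_def complex_eq_iff)
    then show ?thesis by simp
  qed
  then show ?thesis by (simp add: vec_eq_iff)
qed

lemma bilinear_expand:
  fixes H :: "complex ^ 'n::finite \<Rightarrow> complex ^ 'n \<Rightarrow> real"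
  assumes l: "\<And>w. linear (\<lambda>v. H v w)" and r: "\<And>v. linear (H v)"
  shows "H v v = (\<Sum>j\<in>UNIV. \<Sum>k\<in>UNIV.
      H (axis k 1) (axis j 1) * Re (v $ k) * Re (v $ j)
    + H (axis k 1) (axis j \<i>) * Re (v $ k) * Im (v $ j)
    + H (axis k \<i>) (axis j 1) * Im (v $ k) * Re (v $ j)
    + H (axis k \<i>) (axis j \<i>) * Im (v $ k) * Im (v $ j))"
proof -
  have 1: "H v w = (\<Sum>j\<in>UNIV. Re (w $ j) * H v (axis j 1) + Im (w $ j) * H v (axis j \<i>))" for v w
  proof -
    have "H v w = H v (\<Sum>j\<in>UNIV. Re (w $ j) *\<^sub>R axis j 1 + Im (w $ j) *\<^sub>R axis j \<i>)"
      using vec_basis_expand[of w] by simp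
    then show ?thesis by (simp add: linear_sum[OF r] linear_add[OF r] linear_cmul[OF r])
  qed
  have 2: "H v w = (\<Sum>k\<in>UNIV. Re (v $ k) * H (axis k 1) w + Im (v $ k) * H (axis k \<i>) w)" for v w
  proof -
    have "H v w = H (\<Sum>k\<in>UNIV. Re (v $ k) *\<^sub>R axis k 1 + Im (v $ k) *\<^sub>R axis k \<i>) w"
      using vec_basis_expand[of v] by simp
    then show ?thesis by (simp add: linear_sum[OF l] linear_add[OF l] linear_cmul[OF l])
  qed
  show ?thesis
    by (subst 1, subst (1 2) 2)
      (simp add: sum_distrib_left sum.distrib[symmetric] algebra_simps)
qed

lemma fd_of_real:
  assumes "smooth_on S u" "x \<in> S"
  shows "fd (\<lambda>w. complex_of_real (u w)) x v = complex_of_real (fd u x v)"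
  by (rule fd_eqI, rule bounded_linear.has_derivative[OF bounded_linear_of_real])
    (rule smooth_has_derivative[OF assms])

text \<open>
  Both sides are expanded in the real basis of the vectors \<open>axis j 1\<close> and \<open>axis j \<i>\<close>, where they
  agree term by term.
\<close>
lemma Re_levi_form:
  fixes u :: "complex ^ 'n::finite \<Rightarrow> real"
  assumes "open S" "smooth_on S u" "z \<in> S"
  shows "Re (levi_form u z v) = line_lap u z v / 4"
proof -
  let ?U = "\<lambda>w. complex_of_real (u w)"
  have der: "((\<lambda>y. fd ?U y a) has_derivative (\<lambda>w. complex_of_real (hess u z a w))) (at z)" for a
  proof (rule has_derivative_transform_within_open[of _ _ _ UNIV S])
    show "((\<lambda>y. complex_of_real (fd u y a)) has_derivative (\<lambda>w. complex_of_real (hess u z a w))) (at z)"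
      by (rule bounded_linear.has_derivative[OF bounded_linear_of_real], rule smooth_hess[OF assms(2,3)])
  qed (use assms in \<open>auto simp: fd_of_real[OF assms(2)]\<close>)
  have wb: "(wirtinger_bar k ?U has_derivative
      (\<lambda>w. (complex_of_real (hess u z (axis k 1) w) + \<i> * complex_of_real (hess u z (axis k \<i>) w)) / 2)) (at z)" for k
    unfolding wirtinger_bar_def
    by (intro bounded_linear.has_derivative[OF bounded_linear_divide] has_derivative_add
        has_derivative_mult_right der)
  have w: "wirtinger j (wirtinger_bar k ?U) z =
      (of_real (hess u z (axis k 1) (axis j 1)) + \<i> * of_real (hess u z (axis k \<i>) (axis j 1))
       - \<i> * (of_real (hess u z (axis k 1) (axis j \<i>)) + \<i> * of_real (hess u z (axis k \<i>) (axis j \<i>)))) / 4" for j k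
    unfolding wirtinger_def fd_eqI[OF wb] by (simp add: field_simps)
  let ?H = "hess u z"
  have lin: "\<And>w. linear (\<lambda>v. ?H v w)" "\<And>v. linear (?H v)"
    using linear_hess_left linear_hess_right assms by blast+
  show ?thesis
    unfolding line_lap_def bilinear_expand[of ?H, OF lin] levi_form_def w Re_sum sum.distrib[symmetric] sum_divide_distrib
    by (intro sum.cong refl) (simp add: algebra_simps)
qed

section \<open>The maximum principle on discs\<close>

text \<open>
  Subharmonicity at a point in the viscosity sense: a perturbation by a harmonic polynomial
  and a strictly subharmonic quadratic term never creates a local maximum. The real parts of complex
  polynomials suffice as harmonic test functions because they are uniformly dense on the circle.
\<close>
definition subh_at :: "(complex \<Rightarrow> real) \<Rightarrow> complex \<Rightarrow> bool" where
  "subh_at u a \<longleftrightarrow> (\<forall>p \<delta>. \<delta> > 0 \<longrightarrow>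
     \<not> (\<forall>\<^sub>F z in nhds a. u z - Re (poly p z) + \<delta> * (cmod z)\<^sup>2 \<le> u a - Re (poly p a) + \<delta> * (cmod a)\<^sup>2))"

lemma cis_power_mean:
  "((\<lambda>t. cis t ^ n) has_integral (if n = 0 then of_real (2 * pi) else 0)) {0..2 * pi}"
proof (cases "n = 0")
  case True
  then show ?thesis using has_integral_const_real[of "1::complex" 0 "2*pi"]
    by (simp add: scaleR_conv_of_real)
next
  case False
  have "((\<lambda>t. cis (real n * t)) has_integral
      cis (real n * (2 * pi)) / (\<i> * of_nat n) - cis (real n * 0) / (\<i> * of_nat n)) {0..2 * pi}"
  proof (rule fundamental_theorem_of_calculus)
    fix t :: real
    have "((\<lambda>z. exp (\<i> * of_nat n * z) / (\<i> * of_nat n)) has_field_derivative exp (\<i> * of_nat n * of_real t)) (at (of_real t))"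
      using False by (auto intro!: derivative_eq_intros simp: field_simps)
    then have "((\<lambda>t. exp (\<i> * of_nat n * of_real t) / (\<i> * of_nat n)) has_vector_derivative exp (\<i> * of_nat n * of_real t)) (at t within {0..2 * pi})"
      by (rule has_vector_derivative_real_field)
    then show "((\<lambda>t. cis (real n * t) / (\<i> * of_nat n)) has_vector_derivative cis (real n * t)) (at t within {0..2 * pi})"
      by (simp add: cis_conv_exp mult.assoc)
  qed simp
  moreover have "cis (real n * (2 * pi)) = 1"
    using cis_multiple_2pi[of "real n"] by (simp add: mult_ac)
  ultimately show ?thesis unfolding Complex.DeMoivre using False by simp
qed

lemma Re_poly_mean:
  "((\<lambda>t. Re (poly p (a + cis t * w))) has_integral 2 * pi * Re (poly p a)) {0..2 * pi}"
proof -
  let ?q = "pcompose p [:a, w:]"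
  have q: "poly ?q z = poly p (a + z * w)" for z by (simp add: poly_pcompose)
  have "((\<lambda>t. \<Sum>i\<le>degree ?q. coeff ?q i * cis t ^ i) has_integral
      (\<Sum>i\<le>degree ?q. coeff ?q i * (if i = 0 then of_real (2 * pi) else 0))) {0..2 * pi}"
    by (intro has_integral_sum has_integral_mult_right cis_power_mean finite_atMost)
  then have "((\<lambda>t. poly ?q (cis t)) has_integral of_real (2 * pi) * poly ?q 0) {0..2 * pi}"
    by (simp add: poly_altdef[of ?q] poly_0_coeff_0 if_distrib[of "\<lambda>x. _ * x"] sum.delta mult.commute
        cong: if_cong)
  from has_integral_linear[OF this bounded_linear_Re] show ?thesis
    by (simp add: q o_def)
qed

lemma cmod_sq_mean:
  "((\<lambda>t. (cmod (a + cis t * w))\<^sup>2) has_integral 2 * pi * ((cmod a)\<^sup>2 + (cmod w)\<^sup>2)) {0..2 * pi}"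
proof -
  have eq: "(cmod (a + cis t * w))\<^sup>2 = Re (poly [:of_real ((cmod a)\<^sup>2 + (cmod w)\<^sup>2), 2 * cnj a * w:] (0 + cis t * 1))" for t
  proof -
    have "(cmod (a + cis t * w))\<^sup>2 = (cmod a)\<^sup>2 + (cmod (cis t * w))\<^sup>2 + 2 * Re (cnj a * (cis t * w))"
      unfolding cmod_power2 by (simp add: power2_eq_square algebra_simps)
    then show ?thesis by (simp add: norm_mult algebra_simps)
  qed
  show ?thesis unfolding eq
    using Re_poly_mean[of "[:of_real ((cmod a)\<^sup>2 + (cmod w)\<^sup>2), 2 * cnj a * w:]" 0 1] by simp
qed

lemma subh_at_mono:
  assumes "subh_at g a" "g a = u a" "\<forall>\<^sub>F z in nhds a. g z \<le> u z"
  shows "subh_at u a"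
  unfolding subh_at_def
proof (intro allI impI notI)
  fix p and \<delta> :: real assume "\<delta> > 0"
  assume "\<forall>\<^sub>F z in nhds a. u z - Re (poly p z) + \<delta> * (cmod z)\<^sup>2 \<le> u a - Re (poly p a) + \<delta> * (cmod a)\<^sup>2"
  with assms(3) have "\<forall>\<^sub>F z in nhds a. g z - Re (poly p z) + \<delta> * (cmod z)\<^sup>2 \<le> g a - Re (poly p a) + \<delta> * (cmod a)\<^sup>2"
    by eventually_elim (use assms(2) in linarith)
  then show False using assms(1) \<open>\<delta> > 0\<close> unfolding subh_at_def by blast
qed

lemma subh_at_submean:
  assumes "R > 0"
    and "\<And>r. 0 < r \<Longrightarrow> r < R \<Longrightarrow> (\<lambda>t. u (a + cis t * of_real r)) integrable_on {0..2 * pi}"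
    and "\<And>r. 0 < r \<Longrightarrow> r < R \<Longrightarrow> u a \<le> integral {0..2 * pi} (\<lambda>t. u (a + cis t * of_real r)) / (2 * pi)"
  shows "subh_at u a"
  unfolding subh_at_def
proof (intro allI impI notI)
  fix p and \<delta> :: real assume \<delta>: "\<delta> > 0"
  assume "\<forall>\<^sub>F z in nhds a. u z - Re (poly p z) + \<delta> * (cmod z)\<^sup>2 \<le> u a - Re (poly p a) + \<delta> * (cmod a)\<^sup>2"
  then obtain d where d: "d > 0" "\<And>z. dist z a < d \<Longrightarrow>
      u z - Re (poly p z) + \<delta> * (cmod z)\<^sup>2 \<le> u a - Re (poly p a) + \<delta> * (cmod a)\<^sup>2"
    unfolding eventually_nhds_metric by blast
  define r where "r = min R d / 2"
  have r: "0 < r" "r < R" "r < d" using d(1) assms(1) by (auto simp: r_def)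
  let ?K = "u a - Re (poly p a) + \<delta> * (cmod a)\<^sup>2"
  have I: "((\<lambda>t. ?K + Re (poly p (a + cis t * of_real r)) - \<delta> * (cmod (a + cis t * of_real r))\<^sup>2) has_integral
      ((2 * pi - 0) *\<^sub>R ?K + 2 * pi * Re (poly p a) - \<delta> * (2 * pi * ((cmod a)\<^sup>2 + (cmod (of_real r))\<^sup>2)))) {0..2 * pi}"
    by (intro has_integral_add has_integral_diff has_integral_mult_right Re_poly_mean cmod_sq_mean
        has_integral_const_real) (use has_integral_const_real[of ?K 0 "2*pi"] in simp)
  have "integral {0..2 * pi} (\<lambda>t. u (a + cis t * of_real r)) \<le>
      integral {0..2 * pi} (\<lambda>t. ?K + Re (poly p (a + cis t * of_real r)) - \<delta> * (cmod (a + cis t * of_real r))\<^sup>2)"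
  proof (rule integral_le[OF assms(2)[OF r(1,2)] has_integral_integrable[OF I]])
    fix t assume "t \<in> {0..2 * pi}"
    have "dist (a + cis t * of_real r) a < d" using r by (simp add: dist_norm norm_mult)
    from d(2)[OF this]
    show "u (a + cis t * of_real r) \<le> ?K + Re (poly p (a + cis t * of_real r)) - \<delta> * (cmod (a + cis t * of_real r))\<^sup>2"
      by linarith
  qed
  also have "\<dots> = 2 * pi * (u a - \<delta> * r\<^sup>2)"
    using integral_unique[OF I] by (simp add: algebra_simps)
  finally have "u a \<le> 2 * pi * (u a - \<delta> * r\<^sup>2) / (2 * pi)"
    using assms(3)[OF r(1,2)] by (smt (verit) divide_right_mono pi_ge_zero)
  then have "\<delta> * r\<^sup>2 \<le> 0" by simp
  moreover have "\<delta> * r\<^sup>2 > 0" using \<delta> r by simp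
  ultimately show False by simp
qed

text \<open>
  This replaces the Poisson integral as a solution of the Dirichlet problem. On the circle
  \<open>cnj z = 1 / z\<close>, so the real parts of polynomials are closed under products there, and the
  Stone-Weierstrass theorem applies.
\<close>
lemma harmonic_poly_dense:
  assumes "continuous_on (sphere 0 1) u" "e > 0"
  shows "\<exists>p. \<forall>z\<in>sphere 0 1. \<bar>u z - Re (poly p z)\<bar> < e"
proof -
  define R where "R = {f. continuous_on (sphere 0 1) f \<and> (\<exists>p. \<forall>z\<in>sphere 0 1. f z = Re (poly p z))}"
  have cont: "continuous_on S (\<lambda>z. Re (poly p z))" for p and S :: "complex set"
    by (intro continuous_intros)
  have sph: "z * cnj z = 1" if "z \<in> sphere 0 1" for z
    using that by (simp add: complex_norm_square[symmetric])
  \<comment> \<open>\<open>z * cnj z = 1\<close> cancels the common factor of the two tails and lowers the degrees.\<close>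
  have conj: "\<exists>r. \<forall>z\<in>sphere 0 1. Re (poly p z * cnj (poly q z)) = Re (poly r z)" for p q
  proof (induction "degree p + degree q" arbitrary: p q rule: less_induct)
    case less
    obtain a p' where p: "p = pCons a p'" by (cases p)
    obtain b q' where q: "q = pCons b q'" by (cases q)
    have tail: "\<exists>r. \<forall>z\<in>sphere 0 1. Re (poly p' z * cnj (poly q' z)) = Re (poly r z)"
    proof (cases "p' = 0")
      case True
      then show ?thesis by (intro exI[of _ 0]) simp
    next
      case False
      then show ?thesis by (intro less) (auto simp: p q)
    qed
    then obtain r where r: "\<forall>z\<in>sphere 0 1. Re (poly p' z * cnj (poly q' z)) = Re (poly r z)" by blast
    show ?case
    proof (intro exI ballI)
      fix z :: complex assume z: "z \<in> sphere 0 1"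
      have "poly p z * cnj (poly q z) = poly p' z * cnj (poly q' z) * (z * cnj z) + cnj b * (z * poly p' z)
          + a * cnj b + a * cnj (z * poly q' z)"
        by (simp add: p q algebra_simps)
      then have "Re (poly p z * cnj (poly q z)) = Re (poly p' z * cnj (poly q' z)) + Re (cnj b * (z * poly p' z))
          + Re (a * cnj b) + Re (cnj (a * cnj (z * poly q' z)))"
        unfolding sph[OF z] by (simp only: plus_complex.sel cnj.sel mult_1_right)
      then show "Re (poly p z * cnj (poly q z)) =
          Re (poly (r + smult (cnj b) (pCons 0 p') + [:a * cnj b:] + smult (cnj a) (pCons 0 q')) z)"
        using r z by (simp add: algebra_simps)
    qed
  qed
  interpret function_ring_on R "sphere 0 1 :: complex set"
  proof
    show "(\<lambda>x. f x + g x) \<in> R" if fg: "f \<in> R" "g \<in> R" for f g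
    proof -
      obtain p q where "\<forall>z\<in>sphere 0 1. f z = Re (poly p z)" "\<forall>z\<in>sphere 0 1. g z = Re (poly q z)"
        using fg unfolding R_def by blast
      then have "\<forall>z\<in>sphere 0 1. f z + g z = Re (poly (p + q) z)" by simp
      moreover have "continuous_on (sphere 0 1) (\<lambda>x. f x + g x)"
        using fg by (auto simp: R_def intro: continuous_on_add)
      ultimately show ?thesis unfolding R_def by blast
    qed
    show "(\<lambda>x. f x * g x) \<in> R" if fg: "f \<in> R" "g \<in> R" for f g
    proof -
      obtain p q where pq: "\<forall>z\<in>sphere 0 1. f z = Re (poly p z)" "\<forall>z\<in>sphere 0 1. g z = Re (poly q z)"
        using fg unfolding R_def by blast
      obtain r where r: "\<forall>z\<in>sphere 0 1. Re (poly p z * cnj (poly q z)) = Re (poly r z)"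
        using conj by blast
      have "\<forall>z\<in>sphere 0 1. f z * g z = Re (poly (smult (1/2) (p * q + r)) z)"
      proof
        fix z :: complex assume z: "z \<in> sphere 0 1"
        have "f z * g z = (Re (poly p z * poly q z) + Re (poly p z * cnj (poly q z))) / 2"
          using pq z by simp
        then show "f z * g z = Re (poly (smult (1/2) (p * q + r)) z)"
          using r[rule_format, OF z] by (simp add: field_simps)
      qed
      moreover have "continuous_on (sphere 0 1) (\<lambda>x. f x * g x)"
        using fg by (auto simp: R_def intro: continuous_on_mult)
      ultimately show ?thesis unfolding R_def by blast
    qed
    show "(\<lambda>_. c) \<in> R" for c :: real
      unfolding R_def by (auto intro: exI[of _ "[:of_real c:]"])
    show "\<exists>f\<in>R. f x \<noteq> f y" if "x \<noteq> y" for x y :: complex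
    proof -
      have "(\<lambda>z. Re (poly p z)) \<in> R" for p using cont by (auto simp: R_def)
      from this[of "[:0, 1:]"] this[of "[:0, - \<i>:]"] have "Re \<in> R" "Im \<in> R" by simp_all
      then show ?thesis using that complex_eqI by blast
    qed
  qed (auto simp: R_def)
  obtain g where "g \<in> R" "\<forall>z\<in>sphere 0 1. \<bar>u z - g z\<bar> < e"
    using Stone_Weierstrass_basic[OF assms] by blast
  moreover then obtain p where "\<forall>z\<in>sphere 0 1. g z = Re (poly p z)" unfolding R_def by blast
  ultimately show ?thesis by (intro exI[of _ p]) simp
qed

text \<open>
  If \<open>Re p\<close> is close to \<open>u\<close> on the circle, then \<open>u - Re p + \<epsilon> \<bar>z\<bar>\<^sup>2\<close> attains its maximum over the disc
  on the circle, where it is small. Since \<open>Re p\<close> has the mean value property, the inequality for \<open>u\<close>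
  follows up to a multiple of \<open>\<epsilon>\<close>.
\<close>
lemma submean_of_subh:
  assumes "continuous_on (cball 0 1) u" "\<And>a. a \<in> ball 0 1 \<Longrightarrow> subh_at u a"
  shows "u 0 \<le> integral {0..2 * pi} (\<lambda>t. u (cis t)) / (2 * pi)"
proof -
  let ?I = "integral {0..2 * pi} (\<lambda>t. u (cis t))"
  have int: "(\<lambda>t. u (cis t)) integrable_on {0..2 * pi}"
    by (rule integrable_continuous_real, rule continuous_on_compose2[OF assms(1)])
      (auto intro: continuous_intros)
  have "u 0 \<le> ?I / (2 * pi) + e" if "e > 0" for e
  proof -
    define \<epsilon> where "\<epsilon> = e / 3"
    have \<epsilon>: "\<epsilon> > 0" using that by (simp add: \<epsilon>_def)
    have "continuous_on (sphere 0 1) u"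
      by (rule continuous_on_subset[OF assms(1)]) auto
    then obtain p where p: "\<forall>z\<in>sphere 0 1. \<bar>u z - Re (poly p z)\<bar> < \<epsilon>"
      using harmonic_poly_dense \<epsilon> by blast
    define w where "w z = u z - Re (poly p z) + \<epsilon> * (cmod z)\<^sup>2" for z
    have "continuous_on (cball 0 1) w" unfolding w_def
      by (intro continuous_intros assms(1))
    then obtain a where a: "a \<in> cball 0 1" "\<forall>z\<in>cball 0 1. w z \<le> w a"
      using continuous_attains_sup[of "cball 0 1 :: complex set" w] by auto
    have "a \<notin> ball 0 1"
    proof
      assume *: "a \<in> ball 0 1"
      have "\<forall>\<^sub>F z in nhds a. z \<in> ball 0 1" using eventually_nhds_in_open[OF open_ball *] .
      then have "\<forall>\<^sub>F z in nhds a. w z \<le> w a" by eventually_elim (use a in auto)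
      then show False using assms(2)[OF *] \<epsilon> unfolding subh_at_def w_def by blast
    qed
    then have s: "a \<in> sphere 0 1" using a by auto
    have "w 0 \<le> w a" using a by auto
    also have "\<dots> < \<epsilon> + \<epsilon>" using p s unfolding w_def by fastforce
    finally have 1: "u 0 < Re (poly p 0) + 2 * \<epsilon>" by (simp add: w_def)
    have "2 * pi * Re (poly p 0) \<le> ?I + (2 * pi - 0) *\<^sub>R \<epsilon>"
    proof (rule has_integral_le[OF Re_poly_mean[of p 0 1]])
      show "((\<lambda>t. u (cis t) + \<epsilon>) has_integral ?I + (2 * pi - 0) *\<^sub>R \<epsilon>) {0..2 * pi}"
        by (intro has_integral_add integrable_integral int)
          (use has_integral_const_real[of \<epsilon> 0 "2*pi"] in simp)
      fix t
      have "\<bar>u (cis t) - Re (poly p (cis t))\<bar> < \<epsilon>" using p by simp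
      then show "Re (poly p (0 + cis t * 1)) \<le> u (cis t) + \<epsilon>" by simp
    qed
    then have "2 * pi * (Re (poly p 0) - \<epsilon>) \<le> ?I" by (simp add: algebra_simps)
    then have "Re (poly p 0) - \<epsilon> \<le> ?I / (2 * pi)"
      by (simp add: pos_le_divide_eq mult.commute)
    then show ?thesis using 1 by (simp add: \<epsilon>_def)
  qed
  then show ?thesis by (rule field_le_epsilon)
qed

lemma second_derivative_at_max:
  fixes \<phi> :: "real \<Rightarrow> real"
  assumes 1: "\<forall>\<^sub>F s in nhds 0. (\<phi> has_real_derivative \<phi>1 s) (at s)"
    and 2: "(\<phi>1 has_real_derivative d) (at 0)" and 3: "\<forall>\<^sub>F s in nhds 0. \<phi> s \<le> \<phi> 0"
  shows "d \<le> 0"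
proof (rule ccontr)
  assume "\<not> d \<le> 0"
  then have "d > 0" by simp
  obtain e where e: "e > 0" "\<And>s. dist s 0 < e \<Longrightarrow> (\<phi> has_real_derivative \<phi>1 s) (at s) \<and> \<phi> s \<le> \<phi> 0"
    using eventually_conj[OF 1 3] unfolding eventually_nhds_metric by blast
  have "\<phi>1 0 = 0"
    by (rule DERIV_local_max[of \<phi> _ 0 e]) (use e in auto)
  moreover obtain e' where e': "e' > 0" "\<And>h. 0 < h \<Longrightarrow> h < e' \<Longrightarrow> \<phi>1 0 < \<phi>1 (0 + h)"
    using DERIV_pos_inc_right[OF 2 \<open>d > 0\<close>] by blast
  ultimately have pos: "\<phi>1 h > 0" if "0 < h" "h < e'" for h using that by fastforce
  define s where "s = min e e' / 2"
  have s: "0 < s" "s < e" "s < e'" using e e' by (auto simp: s_def)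
  obtain \<xi> where "0 < \<xi>" "\<xi> < s" "\<phi> s - \<phi> 0 = (s - 0) * \<phi>1 \<xi>"
    using MVT2[of 0 s \<phi> \<phi>1] s e(2) by fastforce
  moreover have "\<phi>1 \<xi> > 0" using pos calculation s by auto
  ultimately have "\<phi> s > \<phi> 0" using s by (simp add: algebra_simps) 
  then show False using e(2)[of s] s by auto
qed

lemma cmod_sq_line:
  "(cmod (a + of_real s * e))\<^sup>2 = (cmod a)\<^sup>2 + 2 * s * Re (a * cnj e) + s\<^sup>2 * (cmod e)\<^sup>2"
proof -
  have "Re (a + of_real s * e) = Re a + s * Re e" "Im (a + of_real s * e) = Im a + s * Im e"
    "Re (a * cnj e) = Re a * Re e + Im a * Im e" by simp_all
  then show ?thesis unfolding cmod_power2 by algebra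
qed

lemma vec_line: "z + (a + complex_of_real s * e) *s v = (z + a *s v) + s *\<^sub>R (e *s (v :: complex ^ 'n))"
  unfolding vec_eq_iff
proof
  fix i
  have "(s *\<^sub>R (e *s v)) $ i = complex_of_real s * (e * v $ i)"
    by (simp add: scaleR_conv_of_real[where 'a = complex])
  then show "(z + (a + complex_of_real s * e) *s v) $ i = (z + a *s v + s *\<^sub>R (e *s v)) $ i"
    by (simp add: algebra_simps del: vector_scaleR_component)
qed

lemma smooth_line_derivatives:
  assumes "open S" "smooth_on S f" "x + s *\<^sub>R v \<in> S"
  shows "((\<lambda>s. f (x + s *\<^sub>R v)) has_vector_derivative fd f (x + s *\<^sub>R v) v) (at s)"
    and "((\<lambda>s. fd f (x + s *\<^sub>R v) v) has_vector_derivative hess f (x + s *\<^sub>R v) v v) (at s)"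
proof -
  have l: "((\<lambda>s. x + s *\<^sub>R v) has_derivative (\<lambda>t. t *\<^sub>R v)) (at s)"
    by (auto intro!: derivative_eq_intros)
  show "((\<lambda>s. f (x + s *\<^sub>R v)) has_vector_derivative fd f (x + s *\<^sub>R v) v) (at s)"
    using has_derivative_compose[OF l smooth_has_derivative[OF assms(2,3)]]
    by (simp add: has_vector_derivative_def linear_cmul[OF linear_fd[OF assms(2,3)]])
  show "((\<lambda>s. fd f (x + s *\<^sub>R v) v) has_vector_derivative hess f (x + s *\<^sub>R v) v v) (at s)"
    using has_derivative_compose[OF l smooth_hess[OF assms(2,3)]]
    by (simp add: has_vector_derivative_def linear_cmul[OF linear_hess_right[OF assms(2,3)]])
qed

text \<open>
  At a local maximum of the perturbed function the second derivatives in the directions \<open>1\<close> and \<open>\<i>\<close>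
  are nonpositive. The harmonic part cancels in their sum, and the quadratic term leaves
  \<open>4 \<delta> > 0\<close>. The constant \<open>c\<close> may have any sign; a positive one expresses strictness.
\<close>
lemma subh_at_line_lap:
  fixes f :: "complex ^ 'n::finite \<Rightarrow> real"
  assumes S: "open S" "smooth_on S f" and x: "z + a *s v \<in> S" and line_lap: "line_lap f (z + a *s v) v \<ge> 4 * c"
  shows "subh_at (\<lambda>\<zeta>. f (z + \<zeta> *s v) - c * (cmod \<zeta>)\<^sup>2) a"
  unfolding subh_at_def
proof (intro allI impI notI)
  fix p and \<delta> :: real assume \<delta>: "\<delta> > 0"
  define q where "q \<zeta> = f (z + \<zeta> *s v) - c * (cmod \<zeta>)\<^sup>2 - Re (poly p \<zeta>) + \<delta> * (cmod \<zeta>)\<^sup>2" for \<zeta>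
  assume "\<forall>\<^sub>F \<zeta> in nhds a. f (z + \<zeta> *s v) - c * (cmod \<zeta>)\<^sup>2 - Re (poly p \<zeta>) + \<delta> * (cmod \<zeta>)\<^sup>2
      \<le> f (z + a *s v) - c * (cmod a)\<^sup>2 - Re (poly p a) + \<delta> * (cmod a)\<^sup>2"
  then have max: "\<forall>\<^sub>F \<zeta> in nhds a. q \<zeta> \<le> q a" by (simp add: q_def)
  let ?x = "z + a *s v"
  have dir: "hess f ?x (e *s v) (e *s v) - Re (poly (pderiv (pderiv p)) a * e * e) + 2 * (\<delta> - c) \<le> 0"
    if e: "cmod e = 1" for e
  proof -
    define l where "l s = a + of_real s * e" for s
    have l: "(l has_vector_derivative e) (at s)" for s
      unfolding l_def by (auto intro!: derivative_eq_intros)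
    have P: "((\<lambda>s. poly p (l s)) has_vector_derivative e * poly (pderiv p) (l s)) (at s)" for p s
      using field_vector_diff_chain_at[OF l poly_DERIV] by (simp add: o_def)
    have P1: "((\<lambda>s. Re (poly p (l s))) has_real_derivative Re (e * poly (pderiv p) (l s))) (at s)" for p s
      using bounded_linear.has_vector_derivative[OF bounded_linear_Re P]
      by (simp add: has_real_derivative_iff_has_vector_derivative)
    have P2: "((\<lambda>s. Re (e * poly p (l s))) has_real_derivative Re (e * (e * poly (pderiv p) (l s)))) (at s)" for p s
      using bounded_linear.has_vector_derivative[OF bounded_linear_Re has_vector_derivative_mult_right[OF P]]
      by (simp add: has_real_derivative_iff_has_vector_derivative)
    have qe: "q (l s) = f (?x + s *\<^sub>R (e *s v)) - Re (poly p (l s)) + (\<delta> - c) * ((cmod a)\<^sup>2 + 2 * s * Re (a * cnj e) + s\<^sup>2)" for s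
    proof -
      have "(cmod (l s))\<^sup>2 = (cmod a)\<^sup>2 + 2 * s * Re (a * cnj e) + s\<^sup>2 * (cmod e)\<^sup>2"
        unfolding l_def by (rule cmod_sq_line)
      then show ?thesis using e unfolding q_def l_def vec_line by (simp add: algebra_simps)
    qed
    have "isCont (\<lambda>s. ?x + s *\<^sub>R (e *s v)) 0" by (intro continuous_intros)
    then have "((\<lambda>s. ?x + s *\<^sub>R (e *s v)) \<longlongrightarrow> ?x) (nhds 0)"
      by (simp add: continuous_at tendsto_nhds_iff)
    then have "\<forall>\<^sub>F s in nhds 0. ?x + s *\<^sub>R (e *s v) \<in> S"
      using topological_tendstoD S(1) x by blast
    then have 1: "\<forall>\<^sub>F s in nhds 0. ((\<lambda>s. q (l s)) has_real_derivative
        fd f (?x + s *\<^sub>R (e *s v)) (e *s v) - Re (e * poly (pderiv p) (l s)) + (\<delta> - c) * (2 * Re (a * cnj e) + 2 * s)) (at s)"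
    proof eventually_elim
      case (elim s)
      have "((\<lambda>s. f (?x + s *\<^sub>R (e *s v))) has_real_derivative fd f (?x + s *\<^sub>R (e *s v)) (e *s v)) (at s)"
        using smooth_line_derivatives(1)[OF S elim] by (simp add: has_real_derivative_iff_has_vector_derivative)
      moreover have "((\<lambda>s. (\<delta> - c) * ((cmod a)\<^sup>2 + 2 * s * Re (a * cnj e) + s\<^sup>2)) has_real_derivative
          (\<delta> - c) * (2 * Re (a * cnj e) + 2 * s)) (at s)"
        by (auto intro!: derivative_eq_intros simp: algebra_simps)
      ultimately show ?case unfolding qe
        by (intro DERIV_add DERIV_diff P1)
    qed
    have 2: "((\<lambda>s. fd f (?x + s *\<^sub>R (e *s v)) (e *s v) - Re (e * poly (pderiv p) (l s)) + (\<delta> - c) * (2 * Re (a * cnj e) + 2 * s))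
        has_real_derivative hess f ?x (e *s v) (e *s v) - Re (e * (e * poly (pderiv (pderiv p)) (l 0))) + (\<delta> - c) * 2) (at 0)"
    proof -
      have "((\<lambda>s. fd f (?x + s *\<^sub>R (e *s v)) (e *s v)) has_real_derivative hess f ?x (e *s v) (e *s v)) (at 0)"
        using smooth_line_derivatives(2)[OF S, of ?x 0 "e *s v"] x by (simp add: has_real_derivative_iff_has_vector_derivative)
      moreover have "((\<lambda>s. (\<delta> - c) * (2 * Re (a * cnj e) + 2 * s)) has_real_derivative (\<delta> - c) * 2) (at 0)"
        by (auto intro!: derivative_eq_intros)
      ultimately show ?thesis by (intro DERIV_add DERIV_diff P2)
    qed
    have "isCont l 0" unfolding l_def by (intro continuous_intros)
    then have "(l \<longlongrightarrow> l 0) (nhds 0)" by (simp add: continuous_at tendsto_nhds_iff)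
    then have 3: "\<forall>\<^sub>F s in nhds 0. q (l s) \<le> q (l 0)"
      using max eventually_compose_filterlim[of _ "nhds a" l "nhds 0"] by (simp add: l_def)
    show ?thesis using second_derivative_at_max[OF 1 2 3] by (simp add: l_def mult_ac)
  qed
  have "hess f ?x v v - Re (poly (pderiv (pderiv p)) a) + 2 * (\<delta> - c) \<le> 0"
    using dir[of 1] by simp
  moreover have "hess f ?x (\<i> *s v) (\<i> *s v) + Re (poly (pderiv (pderiv p)) a) + 2 * (\<delta> - c) \<le> 0"
    using dir[of \<i>] by (simp add: mult.assoc)
  ultimately show False using line_lap \<delta> unfolding line_lap_def by simp
qed

lemma norm_complex_scale: "norm (c *s (v :: complex ^ 'n::finite)) = cmod c * norm v"
  by (simp add: norm_vec_def L2_set_right_distrib norm_mult)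

lemma complex_scale_of_real: "complex_of_real r *s v = r *\<^sub>R (v :: complex ^ 'n)"
  unfolding vec_eq_iff
proof
  fix i
  show "(complex_of_real r *s v) $ i = (r *\<^sub>R v) $ i"
    using scaleR_conv_of_real[of r "v $ i"] by simp
qed

lemma bounded_linear_complex_scale: "bounded_linear (\<lambda>v :: complex ^ 'n::finite. c *s v)"
proof (rule bounded_linear_intro[where K = "cmod c"])
  show "c *s (r *\<^sub>R v) = r *\<^sub>R (c *s v)" for r and v :: "complex ^ 'n"
    unfolding complex_scale_of_real[symmetric] by (simp add: vec_eq_iff)
qed (simp_all add: vector_add_ldistrib norm_complex_scale)

lemma bounded_linear_complex_line: "bounded_linear (\<lambda>c. c *s (v :: complex ^ 'n::finite))"
proof (rule bounded_linear_intro[where K = "norm v"])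
  show "(r *\<^sub>R c) *s v = r *\<^sub>R (c *s v)" for r c
    unfolding complex_scale_of_real[symmetric] by (simp add: vec_eq_iff scaleR_conv_of_real)
qed (simp_all add: vector_sadd_rdistrib norm_complex_scale)

lemmas continuous_on_complex_line [continuous_intros] =
  bounded_linear.continuous_on[OF bounded_linear_complex_line]
lemmas continuous_on_complex_scale [continuous_intros] =
  bounded_linear.continuous_on[OF bounded_linear_complex_scale]

lemma psh_on_subh_at:
  assumes S: "open S" "psh_on S u" and x: "z + a *s v \<in> S"
  shows "subh_at (\<lambda>\<zeta>. u (z + \<zeta> *s v)) a"
proof -
  obtain e where e: "e > 0" "ball (z + a *s v) e \<subseteq> S"
    using S(1) x open_contains_ball by blast
  define R where "R = e / (norm v + 1)"
  have pos: "norm v + 1 > 0" by (simp add: add_nonneg_pos)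
  then have R: "R > 0" using e by (simp add: R_def)
  have sub: "(\<lambda>t. u (z + (a + cis t * of_real r) *s v)) absolutely_integrable_on {0..2 * pi} \<and>
      u (z + a *s v) \<le> integral {0..2 * pi} (\<lambda>t. u (z + (a + cis t * of_real r) *s v)) / (2 * pi)"
    if r: "0 < r" "r < R" for r
  proof -
    have "(z + a *s v) + \<zeta> *s (of_real r *s v) \<in> S" if "cmod \<zeta> \<le> 1" for \<zeta>
    proof -
      have "norm (\<zeta> *s (of_real r *s v)) \<le> 1 * (r * norm v)"
        unfolding norm_complex_scale using that r by (intro mult_mono) auto
      also have "\<dots> \<le> r * (norm v + 1)" using r by (simp add: algebra_simps)
      also have "\<dots> < e" using r pos by (simp add: R_def pos_less_divide_eq)
      finally show ?thesis using e by (auto simp: dist_norm)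
    qed
    then have "(\<lambda>t. u ((z + a *s v) + cis t *s (of_real r *s v))) absolutely_integrable_on {0..2 * pi} \<and>
        u (z + a *s v) \<le> integral {0..2 * pi} (\<lambda>t. u ((z + a *s v) + cis t *s (of_real r *s v))) / (2 * pi)"
      using S(2) unfolding psh_on_def by blast
    moreover have eq: "(z + a *s v) + \<zeta> *s (of_real r *s v) = z + (a + \<zeta> * of_real r) *s v" for \<zeta>
      by (simp add: vec_eq_iff algebra_simps)
    ultimately show ?thesis by (simp only: eq)
  qed
  show ?thesis
    by (rule subh_at_submean[OF R])
      (use sub in \<open>auto dest: set_lebesgue_integral_eq_integral(1)\<close>)
qed

lemma psh_on_continuous_iff:
  assumes "continuous_on S u"
  shows "psh_on S u \<longleftrightarrow> (\<forall>z v. (\<forall>\<zeta>. cmod \<zeta> \<le> 1 \<longrightarrow> z + \<zeta> *s v \<in> S) \<longrightarrow>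
      u z \<le> integral {0..2 * pi} (\<lambda>t. u (z + cis t *s v)) / (2 * pi))"
proof -
  have "openin (top_of_set S) {z \<in> S. u z < c}" for c
    using continuous_openin_preimage_gen[OF assms open_lessThan[of c]] by (simp add: vimage_def Int_def)
  moreover have "(\<lambda>t. u (z + cis t *s v)) absolutely_integrable_on {0..2 * pi}"
    if "\<forall>\<zeta>. cmod \<zeta> \<le> 1 \<longrightarrow> z + \<zeta> *s v \<in> S" for z v
    by (rule absolutely_integrable_continuous_real, rule continuous_on_compose2[OF assms])
      (use that in \<open>auto intro!: continuous_intros\<close>)
  ultimately show ?thesis unfolding psh_on_def by blast
qed

text \<open>
  Plurisubharmonicity of a continuous function is a local property: this is how functions that are
  glued from pieces are recognised.
\<close>
lemma psh_onI:
  assumes "open S" "continuous_on S u"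
    and sub: "\<And>z a v. z + a *s v \<in> S \<Longrightarrow> subh_at (\<lambda>\<zeta>. u (z + \<zeta> *s v)) a"
  shows "psh_on S u"
  unfolding psh_on_continuous_iff[OF assms(2)]
proof (intro allI impI)
  fix z v assume disc: "\<forall>\<zeta>. cmod \<zeta> \<le> 1 \<longrightarrow> z + \<zeta> *s v \<in> S"
  have "continuous_on (cball 0 1) (\<lambda>\<zeta>. u (z + \<zeta> *s v))"
    by (rule continuous_on_compose2[OF assms(2)]) (use disc in \<open>auto intro!: continuous_intros\<close>)
  from submean_of_subh[OF this] show "u z \<le> integral {0..2 * pi} (\<lambda>t. u (z + cis t *s v)) / (2 * pi)"
    using sub disc by simp
qed

section \<open>Mollification\<close>

text \<open>
  A family of functions that is flat at \<open>0\<close> and, by the factor \<open>p\<close>, closed under differentiation.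
  The member with \<open>p = 1\<close> is the usual \<open>exp (- 1 / t)\<close>.
\<close>
definition flat_exp :: "real poly \<Rightarrow> real \<Rightarrow> real" where
  "flat_exp p t = (if t > 0 then poly p (1 / t) * exp (- (1 / t)) else 0)"

lemma poly_exp_tendsto_0: "((\<lambda>x. poly p x * exp (- x)) \<longlongrightarrow> (0 :: real)) at_top"
proof -
  have "((\<lambda>x. \<Sum>i\<le>degree p. coeff p i * (x ^ i / exp x)) \<longlongrightarrow> (\<Sum>i\<le>degree p. coeff p i * 0)) at_top"
    by (intro tendsto_sum tendsto_mult_left tendsto_power_div_exp_0)
  then show ?thesis by (simp add: poly_altdef sum_distrib_right exp_minus divide_inverse mult.assoc)
qed

lemma flat_exp_tendsto_0: "((\<lambda>t. flat_exp p t) \<longlongrightarrow> 0) (at_right 0)"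
proof (rule Lim_transform_eventually)
  show "((\<lambda>t. poly p (inverse t) * exp (- inverse t)) \<longlongrightarrow> 0) (at_right 0)"
    by (rule filterlim_compose[OF poly_exp_tendsto_0 filterlim_inverse_at_top_right])
  show "\<forall>\<^sub>F t in at_right 0. poly p (inverse t) * exp (- inverse t) = flat_exp p t"
    unfolding eventually_at_right_field by (intro exI[of _ 1]) (auto simp: flat_exp_def divide_inverse)
qed

lemma flat_exp_has_derivative:
  "(flat_exp p has_real_derivative flat_exp ([:0, 0, 1:] * (p - pderiv p)) t) (at t)"
proof (cases t "0 :: real" rule: linorder_cases)
  case greater
  have "((\<lambda>t. poly p (1 / t) * exp (- (1 / t))) has_real_derivative
      flat_exp ([:0, 0, 1:] * (p - pderiv p)) t) (at t)"
    using greater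
    by (auto intro!: derivative_eq_intros DERIV_chain2[OF poly_DERIV] simp: flat_exp_def field_simps power2_eq_square)
  then show ?thesis
    by (rule has_field_derivative_transform_within[where d = t]) (use greater in \<open>auto simp: flat_exp_def dist_real_def\<close>)
next
  case less
  then have z: "flat_exp q t = 0" for q by (simp add: flat_exp_def)
  have "((\<lambda>t. 0) has_real_derivative 0) (at t)" by simp
  then show ?thesis unfolding z
    by (rule has_field_derivative_transform_within[where d = "- t"]) (use less in \<open>auto simp: flat_exp_def dist_real_def\<close>)
next
  case equal
  have "((\<lambda>h. flat_exp p h / h) \<longlongrightarrow> 0) (at_right 0)"
  proof (rule Lim_transform_eventually[OF flat_exp_tendsto_0[of "pCons 0 p"]])
    show "\<forall>\<^sub>F h in at_right 0. flat_exp (pCons 0 p) h = flat_exp p h / h"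
      unfolding eventually_at_right_field by (intro exI[of _ 1]) (auto simp: flat_exp_def)
  qed
  moreover have "((\<lambda>h. flat_exp p h / h) \<longlongrightarrow> 0) (at_left 0)"
  proof (rule Lim_transform_eventually[OF tendsto_const])
    show "\<forall>\<^sub>F h in at_left 0. 0 = flat_exp p h / h"
      unfolding eventually_at_left_field by (intro exI[of _ "-1"]) (auto simp: flat_exp_def)
  qed
  ultimately have "((\<lambda>h. flat_exp p h / h) \<longlongrightarrow> 0) (at 0)" by (simp add: filterlim_at_split)
  then show ?thesis using equal by (simp add: DERIV_def flat_exp_def)
qed

lemma Ck_on_flat_exp: "Ck_on k UNIV (flat_exp p)"
proof (induction k arbitrary: p)
  case 0
  then show ?case
    using flat_exp_has_derivative DERIV_isCont continuous_at_imp_continuous_on by (metis Ck_on.simps(1))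
next
  case (Suc k)
  show ?case
  proof (rule Ck_on_SucI)
    show "(flat_exp p has_derivative (\<lambda>v. flat_exp ([:0, 0, 1:] * (p - pderiv p)) x * v)) (at x)" for x
      using flat_exp_has_derivative[of p x] unfolding has_field_derivative_def .
    show "Ck_on k UNIV (\<lambda>x. flat_exp ([:0, 0, 1:] * (p - pderiv p)) x * v)" for v
      by (intro Ck_on_mult Ck_on_const Suc.IH) simp
  qed simp
qed

lemma smooth_dist_sq: "smooth_on UNIV (\<lambda>y :: 'a::euclidean_space. (y - c) \<bullet> (y - c))"
  unfolding smooth_on_def
proof
  fix k
  have "Ck_on k UNIV (\<lambda>y :: 'a. (y - c) \<bullet> b)" for b
    unfolding inner_diff_left
    by (intro Ck_on_diff Ck_on_linear Ck_on_const bounded_linear_inner_left) simp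
  then have "Ck_on k UNIV (\<lambda>y :: 'a. \<Sum>b\<in>Basis. ((y - c) \<bullet> b) * ((y - c) \<bullet> b))"
    by (intro Ck_on_sum Ck_on_mult) auto
  then show "Ck_on k UNIV (\<lambda>y :: 'a. (y - c) \<bullet> (y - c))"
    by (simp add: euclidean_inner[symmetric])
qed

text \<open>
  The support is enclosed in a box, on which the integrals are taken, and the box in a ball of
  radius \<open>\<epsilon>\<close>.
\<close>
lemma exists_kernel:
  assumes "\<epsilon> > 0"
  obtains \<kappa> :: "'a::euclidean_space \<Rightarrow> real" and d where
    "smooth_on UNIV \<kappa>" "\<And>y. \<kappa> y \<ge> 0" "\<And>y. y \<notin> cbox (- d) d \<Longrightarrow> \<kappa> y = 0"
    "\<And>y. y \<in> cbox (- d) d \<Longrightarrow> norm y \<le> \<epsilon>" "integral (cbox (- d) d) \<kappa> = 1"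
proof -
  \<comment> \<open>The norm is at most the dimension times the largest coordinate.\<close>
  define s where "s = \<epsilon> / DIM('a)"
  have s: "s > 0" using assms by (simp add: s_def)
  define d :: 'a where "d = s *\<^sub>R One"
  have din: "y \<in> cbox (- d) d \<longleftrightarrow> (\<forall>b\<in>Basis. \<bar>y \<bullet> b\<bar> \<le> s)" for y
    by (auto simp: mem_box d_def abs_le_iff)
  define \<beta> where "\<beta> y = flat_exp 1 (s\<^sup>2 - (y - 0) \<bullet> (y - 0))" for y :: 'a
  have "Ck_on k UNIV (\<lambda>y :: 'a. s\<^sup>2 - (y - 0) \<bullet> (y - 0))" for k
    by (rule Ck_on_diff[OF open_UNIV Ck_on_const smooth_onD[OF smooth_dist_sq]])
  then have \<beta>s: "Ck_on k UNIV \<beta>" for k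
    unfolding \<beta>_def by (rule Ck_on_comp[OF open_UNIV subset_UNIV Ck_on_flat_exp])
  have \<beta>0: "\<beta> y \<ge> 0" for y by (simp add: \<beta>_def flat_exp_def)
  have \<beta>z: "\<beta> y = 0" if "y \<notin> cbox (- d) d" for y
  proof -
    from that obtain b where b: "b \<in> Basis" "\<bar>y \<bullet> b\<bar> > s" using din by force
    then have "norm y > s" using Basis_le_norm[of b y] by simp
    then have "y \<bullet> y > s\<^sup>2" using s unfolding dot_square_norm by (intro power_strict_mono) auto
    then show ?thesis by (simp add: \<beta>_def flat_exp_def)
  qed
  define I where "I = integral (cbox (- d) d) \<beta>"
  have cont: "continuous_on A \<beta>" for A
    using \<beta>s[of 0] continuous_on_subset by force
  have "I \<ge> 0" unfolding I_def by (intro integral_nonneg integrable_continuous cont \<beta>0)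
  moreover have "I \<noteq> 0"
  proof
    assume "I = 0"
    then have "(\<beta> has_integral 0) (cbox (- d) d)"
      using integrable_integral[OF integrable_continuous[OF cont]] unfolding I_def by metis
    moreover have "box (- d) d \<noteq> {}" using s by (auto simp: box_ne_empty d_def)
    moreover have "0 \<in> cbox (- d) d" using s by (simp add: din)
    ultimately have "\<beta> 0 = 0" by (intro has_integral_0_cbox_imp_0[OF cont \<beta>0]) 
    then show False using s by (simp add: \<beta>_def flat_exp_def)
  qed
  ultimately have I: "I > 0" by simp
  show ?thesis
  proof (rule that[of "\<lambda>y. inverse I * \<beta> y" d])
    show "smooth_on UNIV (\<lambda>y. inverse I * \<beta> y)"
      unfolding smooth_on_def by (intro allI Ck_on_cmult \<beta>s) simp
    show "norm y \<le> \<epsilon>" if "y \<in> cbox (- d) d" for y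
    proof -
      have "norm y \<le> (\<Sum>b\<in>Basis. \<bar>y \<bullet> b\<bar>)" by (rule norm_le_l1)
      also have "\<dots> \<le> DIM('a) * s" by (rule sum_bounded_above) (use that din in auto)
      finally show ?thesis by (simp add: s_def)
    qed
    show "integral (cbox (- d) d) (\<lambda>y. inverse I * \<beta> y) = 1"
      using I by (simp add: I_def)
  qed (use \<beta>0 \<beta>z I in auto)
qed

lemma Ck_on_convolution:
  fixes v \<kappa> :: "'a::euclidean_space \<Rightarrow> real"
  assumes "continuous_on (cbox a b) v" "smooth_on UNIV \<kappa>"
  shows "Ck_on k UNIV (\<lambda>z. integral (cbox a b) (\<lambda>y. v y * \<kappa> (z - y)))"
  using assms(2)
proof (induction k arbitrary: \<kappa>)
  case (0 \<kappa>)
  have \<kappa>: "continuous_on UNIV \<kappa>" using smooth_continuous[OF 0] .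
  have "continuous_on (UNIV \<times> cbox a b) (\<lambda>(z, y). v y * \<kappa> (z - y))"
    unfolding case_prod_beta
    by (intro continuous_on_mult continuous_on_compose2[OF assms(1) continuous_on_snd[OF continuous_on_id]]
        continuous_on_compose2[OF \<kappa>
          continuous_on_diff[OF continuous_on_fst[OF continuous_on_id] continuous_on_snd[OF continuous_on_id]]]) auto
  then show ?case using integral_continuous_on_param by fastforce
next
  case (Suc k \<kappa>)
  define F where "F z y = Blinfun (\<lambda>w. v y * fd \<kappa> (z - y) w)" for z y
  have bl: "bounded_linear (\<lambda>w. v y * fd \<kappa> (z - y) w)" for z y
    using smooth_has_derivative[OF Suc.prems, of "z - y"] has_derivative_bounded_linear
      bounded_linear_const_mult by blast
  have F: "blinfun_apply (F z y) = (\<lambda>w. v y * fd \<kappa> (z - y) w)" for z y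
    unfolding F_def by (rule bounded_linear_Blinfun_apply[OF bl])
  have contw: "continuous_on (UNIV \<times> cbox a b) (\<lambda>x. v (snd x) * fd \<kappa> (fst x - snd x) w)" for w
    by (intro continuous_on_mult continuous_on_compose2[OF assms(1) continuous_on_snd[OF continuous_on_id]]
        continuous_on_compose2[OF smooth_continuous[OF smooth_fd[OF Suc.prems]]
          continuous_on_diff[OF continuous_on_fst[OF continuous_on_id] continuous_on_snd[OF continuous_on_id]]]) auto
  have contF: "continuous_on (UNIV \<times> cbox a b) (\<lambda>(z, y). F z y)"
    unfolding case_prod_beta
    by (rule continuous_on_blinfun_componentwise) (simp add: F contw)
  show ?case
  proof (rule Ck_on_SucI)
    fix z
    have "((\<lambda>z. integral (cbox a b) (\<lambda>y. v y * \<kappa> (z - y))) has_derivative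
        integral (cbox a b) (F z)) (at z within UNIV)"
    proof (rule leibniz_rule[OF _ _ contF])
      show "((\<lambda>z. v t * \<kappa> (z - t)) has_derivative blinfun_apply (F x t)) (at x within UNIV)" for x t
      proof -
        have "((\<lambda>z. z - t) has_derivative (\<lambda>w. w)) (at x)" by (auto intro!: derivative_eq_intros)
        from has_derivative_compose[OF this smooth_has_derivative[OF Suc.prems UNIV_I]]
        show ?thesis unfolding F by (auto intro: has_derivative_mult_right)
      qed
      show "(\<lambda>y. v y * \<kappa> (x - y)) integrable_on cbox a b" for x
        by (intro integrable_continuous continuous_on_mult assms(1)
            continuous_on_compose2[OF smooth_continuous[OF Suc.prems]
              continuous_on_diff[OF continuous_on_const continuous_on_id]]) auto
    qed auto
    moreover have "blinfun_apply (integral (cbox a b) (F z)) =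
        (\<lambda>w. integral (cbox a b) (\<lambda>y. v y * fd \<kappa> (z - y) w))"
    proof
      fix w
      have "continuous_on (cbox a b) (\<lambda>y. case (z, y) of (z, y) \<Rightarrow> F z y)"
        by (rule continuous_on_compose2[OF contF continuous_on_Pair[OF continuous_on_const continuous_on_id]]) auto
      then have "continuous_on (cbox a b) (F z)" by simp
      from blinfun_apply_integral[OF integrable_continuous[OF this], of w]
      show "blinfun_apply (integral (cbox a b) (F z)) w = integral (cbox a b) (\<lambda>y. v y * fd \<kappa> (z - y) w)"
        by (simp add: F)
    qed
    ultimately show "((\<lambda>z. integral (cbox a b) (\<lambda>y. v y * \<kappa> (z - y))) has_derivative
        (\<lambda>w. integral (cbox a b) (\<lambda>y. v y * fd \<kappa> (z - y) w))) (at z)"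
      by simp
  next
    show "Ck_on k UNIV (\<lambda>z. integral (cbox a b) (\<lambda>y. v y * fd \<kappa> (z - y) w))" for w
      by (rule Suc.IH[OF smooth_fd[OF Suc.prems]])
  qed simp
qed

text \<open>
  The left-hand side is smooth in \<open>z\<close> because only the kernel depends on \<open>z\<close>; the right-hand side is an
  average of translates of \<open>v\<close>, which inherits sub-mean value inequalities from \<open>v\<close>.
\<close>
lemma convolution_translate:
  fixes v \<kappa> :: "'a::euclidean_space \<Rightarrow> real"
  assumes "continuous_on (cbox a b) v" "continuous_on UNIV \<kappa>"
    and supp: "\<And>y. y \<notin> cbox (- d) d \<Longrightarrow> \<kappa> y = 0"
    and sub: "\<And>y. y \<in> cbox (- d) d \<Longrightarrow> z - y \<in> cbox a b"
  shows "integral (cbox a b) (\<lambda>y. v y * \<kappa> (z - y)) = integral (cbox (- d) d) (\<lambda>y. v (z - y) * \<kappa> y)"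
proof -
  have "continuous_on (cbox (- d) d) (\<lambda>y. v (z - y) * \<kappa> y)"
    by (intro continuous_on_mult continuous_on_subset[OF assms(2)]
        continuous_on_compose2[OF assms(1) continuous_on_diff[OF continuous_on_const continuous_on_id]])
      (use sub in auto)
  then have "((\<lambda>y. v (z - y) * \<kappa> y) has_integral
      integral (cbox (- d) d) (\<lambda>y. v (z - y) * \<kappa> y)) (cbox (- d) d)"
    by (intro integrable_integral integrable_continuous)
  from has_integral_affinity[OF this, of "-1" z]
  have "((\<lambda>x. v x * \<kappa> (z - x)) has_integral integral (cbox (- d) d) (\<lambda>y. v (z - y) * \<kappa> y))
      ((\<lambda>y. z - y) ` cbox (- d) d)"
    by (simp add: algebra_simps)
  then have "((\<lambda>x. v x * \<kappa> (z - x)) has_integral integral (cbox (- d) d) (\<lambda>y. v (z - y) * \<kappa> y)) (cbox a b)"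
  proof (rule has_integral_on_superset)
    fix x assume "x \<notin> (\<lambda>y. z - y) ` cbox (- d) d"
    then have "z - x \<notin> cbox (- d) d" by (metis (no_types, lifting) diff_diff_eq2 add_diff_cancel_left' image_iff)
    then show "v x * \<kappa> (z - x) = 0" using supp by simp
  qed (use sub in auto)
  then show ?thesis by (rule integral_unique)
qed

lemma line_lap_scale:
  fixes f :: "complex ^ 'n::finite \<Rightarrow> real"
  assumes "open S" "smooth_on S f" "z \<in> S"
  shows "line_lap f z (of_real r *s v) = r\<^sup>2 * line_lap f z v"
proof -
  have "\<i> *s (r *\<^sub>R v) = r *\<^sub>R (\<i> *s v)"
    using linear_cmul[OF bounded_linear.linear[OF bounded_linear_complex_scale]] .
  then show ?thesis
    unfolding line_lap_def complex_scale_of_real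
    by (simp add: linear_cmul[OF linear_hess_left[OF assms]] linear_cmul[OF linear_hess_right[OF assms(2,3)]]
        power2_eq_square algebra_simps)
qed

text \<open>
  Were the Laplacian along some complex line negative, it would be so nearby, and the maximum
  principle for \<open>- g - c \<bar>\<zeta>\<bar>\<^sup>2\<close> on a small disc would make the mean of \<open>g\<close> smaller than \<open>g z\<close> by at
  least \<open>c\<close>.
\<close>
lemma line_lap_nonneg_of_submean:
  fixes g :: "complex ^ 'n::finite \<Rightarrow> real"
  assumes g: "smooth_on S g" and S: "open S" "z \<in> S"
    and sub: "\<And>w'. (\<And>\<zeta>. cmod \<zeta> \<le> 1 \<Longrightarrow> z + \<zeta> *s w' \<in> S) \<Longrightarrow>
      g z \<le> integral {0..2 * pi} (\<lambda>t. g (z + cis t *s w')) / (2 * pi)"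
  shows "line_lap g z w \<ge> 0"
proof (rule ccontr)
  assume "\<not> line_lap g z w \<ge> 0"
  define L where "L = line_lap g z w / 2"
  have L: "L < 0" "line_lap g z w < L" using \<open>\<not> line_lap g z w \<ge> 0\<close> by (auto simp: L_def)
  have "continuous_on S (\<lambda>x. line_lap g x w)"
    unfolding line_lap_def by (intro continuous_on_add continuous_hess g)
  then have "open (S \<inter> (\<lambda>x. line_lap g x w) -` {..<L})"
    using continuous_on_open_vimage[OF S(1)] open_lessThan by (metis Int_commute)
  then obtain s where s: "s > 0" "ball z s \<subseteq> S \<inter> (\<lambda>x. line_lap g x w) -` {..<L}"
    using S(2) L(2) open_contains_ball by (metis IntI lessThan_iff vimageI)
  define r where "r = s / (2 * (norm w + 1))"
  have pos: "norm w + 1 > 0" by (simp add: add_nonneg_pos)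
  have r: "r > 0" using s pos by (simp add: r_def)
  define w' where "w' = complex_of_real r *s w"
  have nw: "norm w' < s"
  proof -
    have "norm w' = r * norm w" using r by (simp add: w'_def norm_complex_scale)
    also have "\<dots> \<le> r * (norm w + 1)" using r by simp
    also have "\<dots> = s / 2" using pos by (simp add: r_def field_simps)
    finally show ?thesis using s by simp
  qed
  have disc: "z + \<zeta> *s w' \<in> ball z s" if "cmod \<zeta> \<le> 1" for \<zeta>
  proof -
    have "cmod \<zeta> * norm w' \<le> 1 * norm w'" using that by (intro mult_right_mono) auto
    then show ?thesis using nw by (simp add: dist_norm norm_complex_scale)
  qed
  define c where "c = - (r\<^sup>2 * L) / 4"
  have c: "c > 0" using r L(1) by (simp add: c_def mult_pos_neg)
  have ng: "smooth_on S (\<lambda>x. (-1) * g x)"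
    using Ck_on_cmult[OF S(1) smooth_onD[OF g]] unfolding smooth_on_def by blast
  define F where "F \<zeta> = (-1) * g (z + \<zeta> *s w') - c * (cmod \<zeta>)\<^sup>2" for \<zeta>
  have contg: "continuous_on A (\<lambda>\<zeta>. g (z + \<zeta> *s w'))" if "A \<subseteq> cball 0 1" for A
  proof (rule continuous_on_compose2[OF smooth_continuous[OF g]])
    show "continuous_on A (\<lambda>\<zeta>. z + \<zeta> *s w')" by (intro continuous_intros)
    show "(\<lambda>\<zeta>. z + \<zeta> *s w') ` A \<subseteq> S" using that disc s(2) by fastforce
  qed
  have "F 0 \<le> integral {0..2 * pi} (\<lambda>t. F (cis t)) / (2 * pi)"
  proof (rule submean_of_subh)
    show "continuous_on (cball 0 1) F"
      unfolding F_def by (intro continuous_intros contg) simp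
    fix a :: complex assume "a \<in> ball 0 1"
    then have a: "z + a *s w' \<in> ball z s" by (intro disc) auto
    then have aS: "z + a *s w' \<in> S" "line_lap g (z + a *s w') w < L" using s(2) by auto
    have "line_lap (\<lambda>x. (-1) * g x) (z + a *s w') w' = - line_lap g (z + a *s w') w'"
      unfolding line_lap_def using hess_cmult[OF S(1) g aS(1), of "-1"] by simp
    also have "\<dots> = - (r\<^sup>2 * line_lap g (z + a *s w') w)"
      unfolding w'_def using line_lap_scale[OF S(1) g] aS(1) unfolding w'_def by simp
    also have "\<dots> \<ge> - (r\<^sup>2 * L)" using aS(2) by (simp add: mult_left_mono)
    finally have "4 * c \<le> line_lap (\<lambda>x. (-1) * g x) (z + a *s w') w'" by (simp add: c_def)
    from subh_at_line_lap[OF S(1) ng aS(1) this] show "subh_at F a" unfolding F_def .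
  qed
  moreover have "integral {0..2 * pi} (\<lambda>t. F (cis t)) = - integral {0..2 * pi} (\<lambda>t. g (z + cis t *s w')) - 2 * pi * c"
  proof -
    have "continuous_on {0..2 * pi} (\<lambda>t. g (z + cis t *s w'))"
      by (rule continuous_on_compose2[OF contg[OF order_refl]]) (auto intro!: continuous_intros)
    then have "((\<lambda>t. (-1) * g (z + cis t *s w') - c) has_integral
      (-1) * integral {0..2 * pi} (\<lambda>t. g (z + cis t *s w')) - (2 * pi - 0) *\<^sub>R c) {0..2 * pi}"
      by (intro has_integral_diff has_integral_mult_right integrable_integral integrable_continuous_real)
        (use has_integral_const_real[of c 0 "2*pi"] in simp_all)
    then show ?thesis unfolding F_def by (simp add: integral_unique)
  qed
  moreover have "g z \<le> integral {0..2 * pi} (\<lambda>t. g (z + cis t *s w')) / (2 * pi)"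
    using disc s(2) by (intro sub) auto
  ultimately have "- g z \<le> - (integral {0..2 * pi} (\<lambda>t. g (z + cis t *s w')) / (2 * pi)) - c"
    by (simp add: F_def field_simps)
  then show False using \<open>g z \<le> _\<close> c by linarith
qed

lemma psh_mollification:
  fixes v :: "complex ^ 'n::finite \<Rightarrow> real"
  assumes v: "continuous_on S v" "psh_on S v" and R: "cball c R' \<subseteq> S" "0 < R" "R < R'" and e: "e > 0"
  obtains g where "smooth_on UNIV g" "\<And>z. z \<in> cball c R \<Longrightarrow> \<bar>g z - v z\<bar> < e"
    "\<And>z w. z \<in> ball c R \<Longrightarrow> line_lap g z w \<ge> 0"
proof -
  let ?C = "cball c R'"
  have contv: "continuous_on ?C v" using continuous_on_subset[OF v(1) R(1)] .
  then have "uniformly_continuous_on ?C v" using compact_uniformly_continuous compact_cball by blast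
  then obtain \<delta> where \<delta>: "\<delta> > 0" "\<And>x x'. x \<in> ?C \<Longrightarrow> x' \<in> ?C \<Longrightarrow> dist x' x < \<delta> \<Longrightarrow> dist (v x') (v x) < e / 2"
    using e unfolding uniformly_continuous_on_def by (metis half_gt_zero)
  define \<epsilon> where "\<epsilon> = min (R' - R) (\<delta> / 2)"
  have \<epsilon>: "\<epsilon> > 0" "\<epsilon> \<le> R' - R" "\<epsilon> < \<delta>" using R \<delta> by (auto simp: \<epsilon>_def)
  obtain \<kappa> :: "complex ^ 'n \<Rightarrow> real" and d where \<kappa>: "smooth_on UNIV \<kappa>" "\<And>y. \<kappa> y \<ge> 0"
    "\<And>y. y \<notin> cbox (- d) d \<Longrightarrow> \<kappa> y = 0" "\<And>y. y \<in> cbox (- d) d \<Longrightarrow> norm y \<le> \<epsilon>" "integral (cbox (- d) d) \<kappa> = 1"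
    using exists_kernel[OF \<epsilon>(1)] by blast
  have \<kappa>c: "continuous_on A \<kappa>" for A
    using smooth_continuous[OF \<kappa>(1)] continuous_on_subset by blast
  have near: "z - y \<in> ?C" if "norm (z - c) \<le> R" "y \<in> cbox (- d) d" for z y
  proof -
    have "norm (c - (z - y)) \<le> norm (z - c) + norm y"
      using norm_triangle_ineq4[of y "z - c"] by (simp add: algebra_simps)
    then show ?thesis using \<kappa>(4)[OF that(2)] that(1) \<epsilon>(2) by (simp add: dist_norm)
  qed
  obtain A where A: "?C \<subseteq> cbox (- A) A" using bounded_subset_cbox_symmetric bounded_cball by blast
  \<comment> \<open>A continuous extension to the whole space makes the convolution integral well behaved everywhere.\<close>
  define v' where "v' x = v (closest_point ?C x)" for x
  have v': "v' x = v x" if "x \<in> ?C" for x using that by (simp add: v'_def closest_point_self)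
  have contv': "continuous_on T v'" for T
    unfolding v'_def
  proof (rule continuous_on_compose2[OF contv])
    show "continuous_on T (closest_point ?C)" using R by (intro continuous_on_closest_point) auto
    show "closest_point ?C ` T \<subseteq> ?C" using R closest_point_in_set[of ?C] by fastforce
  qed
  define g where "g z = integral (cbox (- A) A) (\<lambda>y. v' y * \<kappa> (z - y))" for z
  have g: "smooth_on UNIV g"
    unfolding smooth_on_def g_def using Ck_on_convolution[OF contv' \<kappa>(1)] by blast
  have gt: "g z = integral (cbox (- d) d) (\<lambda>y. v' (z - y) * \<kappa> y)" if "norm (z - c) \<le> R" for z
    unfolding g_def using near[OF that] A by (intro convolution_translate contv' \<kappa>c \<kappa>(3)) auto
  have contvk: "continuous_on (cbox (- d) d) (\<lambda>y. v' (z - y) * \<kappa> y)" for z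
    by (intro continuous_on_mult \<kappa>c continuous_on_compose2[OF contv'[of UNIV]] continuous_intros) auto
  have intk: "\<kappa> integrable_on cbox (- d) d" by (rule integrable_continuous[OF \<kappa>c])
  have close: "\<bar>g z - v z\<bar> < e" if z: "z \<in> cball c R" for z
  proof -
    have zc: "norm (z - c) \<le> R" "z \<in> ?C" using z R by (auto simp: dist_norm norm_minus_commute)
    have I1: "((\<lambda>y. v' (z - y) * \<kappa> y - v z * \<kappa> y) has_integral g z - v z * 1) (cbox (- d) d)"
      unfolding gt[OF zc(1)] using \<kappa>(5) intk
      by (intro has_integral_diff integrable_integral integrable_continuous contvk has_integral_mult_right)
        (metis integrable_integral)
    have I2: "((\<lambda>y. e / 2 * \<kappa> y) has_integral e / 2 * 1) (cbox (- d) d)"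
      using \<kappa>(5) intk by (intro has_integral_mult_right) (metis integrable_integral)
    have "norm (g z - v z * 1) \<le> e / 2 * 1"
      unfolding integral_unique[OF I1, symmetric] integral_unique[OF I2, symmetric]
    proof (rule integral_norm_bound_integral[OF has_integral_integrable[OF I1] has_integral_integrable[OF I2]])
      fix y assume y: "y \<in> cbox (- d) d"
      have "dist (z - y) z < \<delta>" using \<kappa>(4)[OF y] \<epsilon>(3) by (simp add: dist_norm)
      then have "\<bar>v' (z - y) - v z\<bar> \<le> e / 2"
        using \<delta>(2)[OF zc(2) near[OF zc(1) y]] v'[OF near[OF zc(1) y]] by (simp add: dist_real_def)
      then have "\<bar>v' (z - y) - v z\<bar> * \<kappa> y \<le> e / 2 * \<kappa> y" using \<kappa>(2) by (rule mult_right_mono)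
      then show "norm (v' (z - y) * \<kappa> y - v z * \<kappa> y) \<le> e / 2 * \<kappa> y"
        using \<kappa>(2)[of y] by (simp add: abs_mult left_diff_distrib[symmetric])
    qed
    then show ?thesis using e by simp
  qed
  have "line_lap g z w \<ge> 0" if z: "z \<in> ball c R" for z w
  proof (rule line_lap_nonneg_of_submean[OF _ open_ball z])
    show "smooth_on (ball c R) g"
      using g unfolding smooth_on_def by (meson Ck_on_subset subset_UNIV)
    fix w' assume disc: "\<And>\<zeta>. cmod \<zeta> \<le> 1 \<Longrightarrow> z + \<zeta> *s w' \<in> ball c R"
    then have dc: "norm (z + \<zeta> *s w' - c) \<le> R" if "cmod \<zeta> \<le> 1" for \<zeta>
      using that by (simp add: dist_norm norm_minus_commute less_imp_le)
    have z': "norm (z - c) \<le> R" using dc[of 0] by simp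
    let ?J = "\<lambda>y. integral {0..2 * pi} (\<lambda>t. v' (z + cis t *s w' - y) * \<kappa> y)"
    have c2: "continuous_on (cbox (0, - d) (2 * pi, d)) (\<lambda>(t, y). v' (z + cis t *s w' - y) * \<kappa> y)"
      unfolding case_prod_beta
    proof (intro continuous_on_mult)
      show "continuous_on (cbox (0, - d) (2 * pi, d)) (\<lambda>x. v' (z + cis (fst x) *s w' - snd x))"
        by (rule continuous_on_compose2[OF contv'[of UNIV]]) (auto intro!: continuous_intros)
      show "continuous_on (cbox (0, - d) (2 * pi, d)) (\<lambda>x. \<kappa> (snd x))"
        by (rule continuous_on_compose2[OF \<kappa>c[of UNIV]]) (auto intro!: continuous_intros)
    qed
    have "integral {0..2 * pi} (\<lambda>t. g (z + cis t *s w')) =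
        integral (cbox 0 (2 * pi)) (\<lambda>t. integral (cbox (- d) d) (\<lambda>y. v' (z + cis t *s w' - y) * \<kappa> y))"
      using gt dc by simp
    also have "\<dots> = integral (cbox (- d) d) ?J"
      using integral_swap_continuous[OF c2] by simp
    also have "\<dots> \<ge> integral (cbox (- d) d) (\<lambda>y. 2 * pi * (v' (z - y) * \<kappa> y))"
    proof (rule integral_le)
      show "(\<lambda>y. 2 * pi * (v' (z - y) * \<kappa> y)) integrable_on cbox (- d) d"
        by (intro integrable_continuous continuous_on_mult continuous_on_const contvk)
      have "continuous_on (cbox (- d) d \<times> cbox 0 (2 * pi)) (\<lambda>(y, t). v' (z + cis t *s w' - y) * \<kappa> y)"
        unfolding case_prod_beta
      proof (intro continuous_on_mult)
        show "continuous_on (cbox (- d) d \<times> cbox 0 (2 * pi)) (\<lambda>x. v' (z + cis (snd x) *s w' - fst x))"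
          by (rule continuous_on_compose2[OF contv'[of UNIV]]) (auto intro!: continuous_intros)
        show "continuous_on (cbox (- d) d \<times> cbox 0 (2 * pi)) (\<lambda>x. \<kappa> (fst x))"
          by (rule continuous_on_compose2[OF \<kappa>c[of UNIV]]) (auto intro!: continuous_intros)
      qed
      from integral_continuous_on_param[OF this]
      show "?J integrable_on cbox (- d) d" by (intro integrable_continuous) simp
      fix y assume y: "y \<in> cbox (- d) d"
      have dS: "z - y + \<zeta> *s w' \<in> ?C" if "cmod \<zeta> \<le> 1" for \<zeta>
        using near[OF dc[OF that] y] by (simp add: algebra_simps)
      then have "v (z - y) \<le> integral {0..2 * pi} (\<lambda>t. v (z - y + cis t *s w')) / (2 * pi)"
        using v(2) R(1) unfolding psh_on_def by blast
      also have "(\<lambda>t. v (z - y + cis t *s w')) = (\<lambda>t. v' (z + cis t *s w' - y))"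
        using v' dS by (simp add: fun_eq_iff algebra_simps)
      finally have "2 * pi * v' (z - y) \<le> integral {0..2 * pi} (\<lambda>t. v' (z + cis t *s w' - y))"
        using v' dS[of 0] by (simp add: pos_le_divide_eq mult.commute)
      from mult_right_mono[OF this \<kappa>(2)[of y]]
      show "2 * pi * (v' (z - y) * \<kappa> y) \<le> ?J y" by (simp add: mult.assoc)
    qed
    also have "integral (cbox (- d) d) (\<lambda>y. 2 * pi * (v' (z - y) * \<kappa> y)) = 2 * pi * g z"
      using gt[OF z'] by simp
    finally show "g z \<le> integral {0..2 * pi} (\<lambda>t. g (z + cis t *s w')) / (2 * pi)"
      by (simp add: pos_le_divide_eq mult.commute)
  qed
  with g close show ?thesis by (rule that)
qed

section \<open>Holomorphic maps\<close>

text \<open>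
  The components of holomorphic maps. Continuity of the derivative is a consequence, by Cauchy's
  formula on complex lines.
\<close>
definition hol_fun :: "(complex ^ 'n::finite \<Rightarrow> complex) \<Rightarrow> (complex ^ 'n) set \<Rightarrow> bool" where
  "hol_fun f S \<longleftrightarrow> (\<forall>z\<in>S. \<exists>D. (f has_derivative D) (at z) \<and> (\<forall>c v. D (c *s v) = c * D v))"

lemma hol_fun_D:
  assumes "hol_fun f S" "z \<in> S"
  shows "(f has_derivative frechet_derivative f (at z)) (at z)" "fd f z (c *s v) = c * fd f z v"
proof -
  obtain D where D: "(f has_derivative D) (at z)" "\<And>c v. D (c *s v) = c * D v"
    using assms unfolding hol_fun_def by blast
  then have "frechet_derivative f (at z) = D" using frechet_derivative_at by metis
  then show "(f has_derivative frechet_derivative f (at z)) (at z)" "fd f z (c *s v) = c * fd f z v"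
    using D by auto
qed

lemma hol_fun_continuous: "hol_fun f S \<Longrightarrow> continuous_on S f"
  using hol_fun_D(1) has_derivative_continuous continuous_at_imp_continuous_on by metis

lemma hol_fun_line:
  assumes "hol_fun f S" "z + a *s v \<in> S"
  shows "((\<lambda>\<zeta>. f (z + \<zeta> *s v)) has_field_derivative fd f (z + a *s v) v) (at a)"
proof -
  have "((\<lambda>\<zeta>. z + \<zeta> *s v) has_derivative (\<lambda>\<zeta>. \<zeta> *s v)) (at a)"
    using has_derivative_add[OF has_derivative_const bounded_linear_imp_has_derivative[OF bounded_linear_complex_line]]
    by simp
  from has_derivative_compose[OF this hol_fun_D(1)[OF assms]]
  have "((\<lambda>\<zeta>. f (z + \<zeta> *s v)) has_derivative (\<lambda>\<zeta>. fd f (z + a *s v) v * \<zeta>)) (at a)"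
    by (simp add: hol_fun_D(2)[OF assms] mult.commute)
  then show ?thesis by (simp add: has_field_derivative_def)
qed

definition circle_point :: "real \<Rightarrow> real \<Rightarrow> complex" where
  "circle_point r t = of_real r * exp (2 * of_real pi * \<i> * of_real t)"

lemma norm_circle_point: "r > 0 \<Longrightarrow> cmod (circle_point r t) = r"
  by (simp add: circle_point_def norm_mult norm_exp_eq_Re)

lemma circle_point_nonzero: "r > 0 \<Longrightarrow> circle_point r t \<noteq> 0"
  using norm_circle_point[of r t] by auto

lemma hol_fun_cauchy:
  assumes f: "hol_fun f S" and r: "r > 0" and disc: "\<And>\<zeta>. cmod \<zeta> \<le> r \<Longrightarrow> z + \<zeta> *s v \<in> S"
  shows "fd f z v = integral {0..1} (\<lambda>t. f (z + circle_point r t *s v) / circle_point r t)"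
proof -
  let ?F = "\<lambda>\<zeta>. f (z + \<zeta> *s v)"
  have d: "(?F has_field_derivative fd f (z + a *s v) v) (at a)" if "cmod a \<le> r" for a
    using hol_fun_line[OF f disc[OF that]] .
  have cont: "continuous_on (cball 0 r) ?F"
    by (intro continuous_at_imp_continuous_on ballI DERIV_isCont[OF d]) simp
  have hol: "?F holomorphic_on ball 0 r"
    unfolding holomorphic_on_open[OF open_ball] by (intro ballI exI, rule d) simp
  have "(?F has_field_derivative (1 / (2 * of_real pi * \<i>) *
      contour_integral (circlepath 0 r) (\<lambda>u. ?F u / (u - 0)^2))) (at 0)"
    by (rule Cauchy_derivative_integral_circlepath(2)[OF cont hol]) (use r in simp)
  then have "fd f z v = 1 / (2 * of_real pi * \<i>) * contour_integral (circlepath 0 r) (\<lambda>u. ?F u / (u - 0)^2)"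
    using d[of 0] r DERIV_unique by fastforce
  also have "\<dots> = 1 / (2 * of_real pi * \<i>) * integral {0..1} (\<lambda>t. 2 * of_real pi * \<i> * (?F (circle_point r t) / circle_point r t))"
  proof -
    have "?F (circlepath 0 r t) / (circlepath 0 r t - 0)^2 * vector_derivative (circlepath 0 r) (at t) =
        2 * of_real pi * \<i> * (?F (circle_point r t) / circle_point r t)" for t
      unfolding vector_derivative_circlepath using circle_point_nonzero[OF r, of t]
      by (simp add: circlepath circle_point_def power2_eq_square)
    then show ?thesis unfolding contour_integral_integral by simp
  qed
  also have "\<dots> = integral {0..1} (\<lambda>t. ?F (circle_point r t) / circle_point r t)"
    by (subst integral_mult_right) simp
  finally show ?thesis .
qed

lemma continuous_circle_point [continuous_intros]: "continuous_on A g \<Longrightarrow> continuous_on A (\<lambda>x. circle_point r (g x))"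
  unfolding circle_point_def by (intro continuous_intros)

lemma hol_fun_disc_neighbourhood:
  assumes f: "hol_fun f S" and S: "open S" "z0 \<in> S"
  obtains e r where "e > 0" "r > 0" "ball z0 e \<subseteq> S"
    "\<And>z \<zeta>. z \<in> ball z0 e \<Longrightarrow> cmod \<zeta> \<le> r \<Longrightarrow> z + \<zeta> *s v \<in> S"
proof -
  obtain d where d: "d > 0" "ball z0 d \<subseteq> S" using S open_contains_ball by blast
  have pos: "norm v + 1 > 0" by (simp add: add_nonneg_pos)
  define r where "r = d / 2 / (norm v + 1)"
  have r: "r > 0" using d pos by (simp add: r_def)
  show ?thesis
  proof (rule that[of "d / 2" r])
    fix z \<zeta> assume z: "z \<in> ball z0 (d / 2)" and \<zeta>: "cmod \<zeta> \<le> r"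
    have "norm (\<zeta> *s v) \<le> r * (norm v + 1)"
      unfolding norm_complex_scale using \<zeta> r by (intro mult_mono) auto
    also have "\<dots> = d / 2" using pos by (simp add: r_def field_simps)
    finally have "dist z0 (z + \<zeta> *s v) < d"
      using z dist_triangle[of z0 "z + \<zeta> *s v" z] by (simp add: dist_norm)
    then show "z + \<zeta> *s v \<in> S" using d by auto
  qed (use d r in auto)
qed

lemma hol_fun_cauchy_integrand_continuous:
  assumes g: "continuous_on S g" and r: "r > 0"
    and disc: "\<And>z \<zeta>. z \<in> A \<Longrightarrow> cmod \<zeta> \<le> r \<Longrightarrow> z + \<zeta> *s v \<in> S"
  shows "continuous_on (A \<times> cbox 0 1) (\<lambda>(z, t). (g (z + circle_point r t *s v) :: complex) / circle_point r t)"
  unfolding case_prod_beta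
proof (intro continuous_on_divide)
  show "continuous_on (A \<times> cbox 0 1) (\<lambda>x. g (fst x + circle_point r (snd x) *s v))"
    by (rule continuous_on_compose2[OF g])
      (use disc norm_circle_point[OF r] in \<open>auto intro!: continuous_intros\<close>)
  show "continuous_on (A \<times> cbox 0 1) (\<lambda>x. circle_point r (snd x))" by (intro continuous_intros)
  show "\<forall>x\<in>A \<times> cbox 0 1. circle_point r (snd x) \<noteq> 0" using circle_point_nonzero[OF r] by blast
qed

lemma hol_fun_deriv_continuous:
  assumes f: "hol_fun f S" and S: "open S"
  shows "continuous_on S (\<lambda>z. fd f z v)"
  unfolding continuous_on_eq_continuous_at[OF S]
proof
  fix z0 assume "z0 \<in> S"
  then obtain e r where er: "e > 0" "r > 0" "ball z0 e \<subseteq> S"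
    "\<And>z \<zeta>. z \<in> ball z0 e \<Longrightarrow> cmod \<zeta> \<le> r \<Longrightarrow> z + \<zeta> *s v \<in> S"
    using hol_fun_disc_neighbourhood[OF f S] by metis
  have "continuous_on (ball z0 e \<times> cbox 0 1) (\<lambda>(z, t). f (z + circle_point r t *s v) / circle_point r t)"
    by (rule hol_fun_cauchy_integrand_continuous[OF hol_fun_continuous[OF f] er(2)]) (rule er(4))
  from integral_continuous_on_param[OF this]
  have "continuous_on (ball z0 e) (\<lambda>z. integral {0..1} (\<lambda>t. f (z + circle_point r t *s v) / circle_point r t))"
    by simp
  moreover have "integral {0..1} (\<lambda>t. f (z + circle_point r t *s v) / circle_point r t) = fd f z v" if "z \<in> ball z0 e" for z
    by (rule hol_fun_cauchy[symmetric, OF f er(2)]) (rule er(4)[OF that])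
  ultimately have "continuous_on (ball z0 e) (\<lambda>z. fd f z v)"
    by (rule continuous_on_eq)
  then show "isCont (\<lambda>z. fd f z v) z0"
    using er(1) by (simp add: continuous_on_eq_continuous_at)
qed

text \<open>
  Differentiation of Cauchy's formula under the integral sign. The integral of the complex linear
  derivatives is complex linear again, so iteration gives derivatives of all orders.
\<close>
lemma hol_fun_deriv:
  assumes f: "hol_fun f S" and S: "open S"
  shows "hol_fun (\<lambda>z. fd f z v) S"
  unfolding hol_fun_def
proof
  fix z0 assume "z0 \<in> S"
  then obtain e r where er: "e > 0" "r > 0" "ball z0 e \<subseteq> S"
    "\<And>z \<zeta>. z \<in> ball z0 e \<Longrightarrow> cmod \<zeta> \<le> r \<Longrightarrow> z + \<zeta> *s v \<in> S"
    using hol_fun_disc_neighbourhood[OF f S] by metis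
  let ?B = "ball z0 e"
  have inS: "z + circle_point r t *s v \<in> S" if "z \<in> ?B" for z t
    using er(4)[OF that] norm_circle_point[OF er(2)] by simp
  define F where "F z t = Blinfun (\<lambda>w. fd f (z + circle_point r t *s v) w / circle_point r t)" for z t
  have F: "blinfun_apply (F z t) = (\<lambda>w. fd f (z + circle_point r t *s v) w / circle_point r t)" if "z \<in> ?B" for z t
    unfolding F_def
    by (rule bounded_linear_Blinfun_apply, rule bounded_linear_compose[OF bounded_linear_divide])
      (rule has_derivative_bounded_linear[OF hol_fun_D(1)[OF f inS[OF that]]])
  have contf: "continuous_on (?B \<times> cbox 0 1) (\<lambda>(z, t). f (z + circle_point r t *s v) / circle_point r t)"
    by (rule hol_fun_cauchy_integrand_continuous[OF hol_fun_continuous[OF f] er(2)]) (rule er(4))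
  have cauchy: "integral (cbox 0 1) (\<lambda>t. f (z + circle_point r t *s v) / circle_point r t) = fd f z v" if "z \<in> ?B" for z
    using hol_fun_cauchy[OF f er(2) er(4)[OF that]] by simp
  have contF: "continuous_on (?B \<times> cbox 0 1) (\<lambda>(z, t). F z t)"
  proof -
    have "continuous_on (?B \<times> cbox 0 1) (\<lambda>x. F (fst x) (snd x))"
    proof (rule continuous_on_blinfun_componentwise)
      fix b
      have "continuous_on (?B \<times> cbox 0 1) (\<lambda>(z, t). fd f (z + circle_point r t *s v) b / circle_point r t)"
        by (rule hol_fun_cauchy_integrand_continuous[OF hol_fun_deriv_continuous[OF f S] er(2)]) (rule er(4))
      then show "continuous_on (?B \<times> cbox 0 1) (\<lambda>x. blinfun_apply (F (fst x) (snd x)) b)"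
        by (rule continuous_on_eq) (auto simp: F)
    qed
    then show ?thesis by (simp add: case_prod_beta)
  qed
  have "((\<lambda>z. integral (cbox 0 1) (\<lambda>t. f (z + circle_point r t *s v) / circle_point r t)) has_derivative
      integral (cbox 0 1) (F z0)) (at z0 within ?B)"
  proof (rule leibniz_rule[OF _ _ contF])
    fix z t assume z: "z \<in> ?B"
    have "((\<lambda>z. z + circle_point r t *s v) has_derivative (\<lambda>w. w)) (at z)" by (auto intro!: derivative_eq_intros)
    from has_derivative_compose[OF this hol_fun_D(1)[OF f inS[OF z]]]
    have "((\<lambda>z. f (z + circle_point r t *s v) / circle_point r t) has_derivative (\<lambda>w. fd f (z + circle_point r t *s v) w / circle_point r t)) (at z)"
      by (rule bounded_linear.has_derivative[OF bounded_linear_divide])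
    then show "((\<lambda>z. f (z + circle_point r t *s v) / circle_point r t) has_derivative blinfun_apply (F z t)) (at z within ?B)"
      unfolding F[OF z] by (rule has_derivative_at_withinI)
  next
    fix z assume z: "z \<in> ?B"
    have "continuous_on (cbox 0 1) (\<lambda>t. case (z, t) of (z, t) \<Rightarrow> f (z + circle_point r t *s v) / circle_point r t)"
      by (rule continuous_on_compose2[OF contf
            continuous_on_Pair[OF continuous_on_const continuous_on_id]]) (use z in auto)
    then show "(\<lambda>t. f (z + circle_point r t *s v) / circle_point r t) integrable_on cbox 0 1"
      by (intro integrable_continuous) simp
  qed (use er in auto)
  then have "((\<lambda>z. integral (cbox 0 1) (\<lambda>t. f (z + circle_point r t *s v) / circle_point r t)) has_derivative
      integral (cbox 0 1) (F z0)) (at z0)"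
    using er(1) by (simp add: at_within_open[OF _ open_ball])
  then have "((\<lambda>z. fd f z v) has_derivative integral (cbox 0 1) (F z0)) (at z0)"
    by (rule has_derivative_transform_within_open[OF _ open_ball[of z0 e]])
      (use er(1) cauchy in auto)
  moreover have "blinfun_apply (integral (cbox 0 1) (F z0)) (c *s w) =
      c * blinfun_apply (integral (cbox 0 1) (F z0)) w" for c w
  proof -
    have z0: "z0 \<in> ?B" using er by simp
    have "continuous_on (cbox 0 1) (\<lambda>t. case (z0, t) of (z0, t) \<Rightarrow> F z0 t)"
      by (rule continuous_on_compose2[OF contF continuous_on_Pair[OF continuous_on_const continuous_on_id]])
        (use z0 in auto)
    then have "F z0 integrable_on cbox 0 1" by (intro integrable_continuous) simp
    note ap = blinfun_apply_integral[OF this]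
    show ?thesis unfolding ap F[OF z0] hol_fun_D(2)[OF f inS[OF z0]]
      by (simp only: times_divide_eq_right[symmetric] integral_mult_right)
  qed
  ultimately show "\<exists>D. ((\<lambda>z. fd f z v) has_derivative D) (at z0) \<and> (\<forall>c w. D (c *s w) = c * D w)"
    by blast
qed

lemma hol_fun_Ck_on: "hol_fun f S \<Longrightarrow> open S \<Longrightarrow> Ck_on k S f"
proof (induction k arbitrary: f)
  case 0
  then show ?case by (simp add: hol_fun_continuous)
next
  case (Suc k)
  show ?case
    by (rule Ck_on_SucI[OF Suc.prems(2) hol_fun_D(1)[OF Suc.prems(1)]])
      (auto intro: Suc.IH hol_fun_deriv Suc.prems)
qed

context
  fixes h :: "complex ^ 'n::finite \<Rightarrow> complex ^ 'm::finite" and S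
  assumes h: "holomorphic_map_on h S" and S: "open S"
begin

lemma hol_component: "hol_fun (\<lambda>z. h z $ i) S"
  unfolding hol_fun_def
proof
  fix z assume "z \<in> S"
  then obtain D where D: "(h has_derivative D) (at z)" "\<forall>c v. D (c *s v) = c *s D v"
    using h unfolding holomorphic_map_on_def by blast
  have "((\<lambda>z. h z $ i) has_derivative (\<lambda>v. D v $ i)) (at z)"
    by (rule bounded_linear.has_derivative[OF bounded_linear_vec_nth D(1)])
  then show "\<exists>D. ((\<lambda>z. h z $ i) has_derivative D) (at z) \<and> (\<forall>c v. D (c *s v) = c * D v)"
    using D(2) by (intro exI[of _ "\<lambda>v. D v $ i"]) simp
qed

lemma hol_smooth: "smooth_on S h"
  unfolding smooth_on_def
proof
  fix k
  have "Ck_on k S (\<lambda>z. \<Sum>i\<in>UNIV. (h z $ i) *s axis i 1)"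
    by (intro Ck_on_sum Ck_on_linear_comp[OF S bounded_linear_complex_line] hol_fun_Ck_on hol_component S) simp
  then show "Ck_on k S h" by (simp add: basis_expansion)
qed

lemma hol_fd_nth: "z \<in> S \<Longrightarrow> fd h z v $ i = fd (\<lambda>z. h z $ i) z v"
  using fd_eqI[OF bounded_linear.has_derivative[OF bounded_linear_vec_nth smooth_has_derivative[OF hol_smooth]]]
  by metis

lemma hol_fd_scale: "z \<in> S \<Longrightarrow> fd h z (c *s v) = c *s fd h z v"
  by (simp add: vec_eq_iff hol_fd_nth hol_fun_D(2)[OF hol_component])

lemma hol_hess_nth:
  assumes "z \<in> S" shows "hess h z v w $ i = fd (\<lambda>y. fd (\<lambda>z. h z $ i) y v) z w"
proof -
  have "frechet_derivative (\<lambda>y. fd (\<lambda>z. h z $ i) y v) (at z) = frechet_derivative (\<lambda>y. fd h y v $ i) (at z)"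
    by (rule fd_cong_open[OF S assms]) (simp add: hol_fd_nth)
  moreover have "fd (\<lambda>y. fd h y v $ i) z w = hess h z v w $ i"
    by (rule fd_eqI, rule bounded_linear.has_derivative[OF bounded_linear_vec_nth])
      (rule smooth_hess[OF hol_smooth assms])
  ultimately show ?thesis by simp
qed

text \<open>The second derivative of a holomorphic map is complex bilinear.\<close>
lemma hol_hess_i: assumes "z \<in> S" shows "hess h z (\<i> *s v) (\<i> *s v) = - hess h z v v"
proof -
  have "hess h z (\<i> *s v) w = \<i> *s hess h z v w" for w
    by (rule hess_eqI[OF S assms, of _ _ "\<lambda>y. \<i> *s fd h y v"])
      (auto simp: hol_fd_scale intro: bounded_linear.has_derivative[OF bounded_linear_complex_scale]
        smooth_hess[OF hol_smooth assms])
  moreover have "hess h z v (\<i> *s v) = \<i> *s hess h z v v"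
    by (simp add: vec_eq_iff hol_hess_nth[OF assms] hol_fun_D(2)[OF hol_fun_deriv[OF hol_component S] assms])
  ultimately show ?thesis by (simp add: vec_eq_iff)
qed

end

lemma hess_comp:
  fixes f :: "'b::euclidean_space \<Rightarrow> real" and h :: "'a::real_normed_vector \<Rightarrow> 'b"
  assumes S: "open S" "x \<in> S" and T: "open T" "h ` S \<subseteq> T" and f: "smooth_on T f" and h: "smooth_on S h"
  shows "hess (\<lambda>y. f (h y)) x v w = hess f (h x) (fd h x v) (fd h x w) + fd f (h x) (hess h x v w)"
proof -
  have hx: "h x \<in> T" using S T by blast
  have e: "fd (\<lambda>y. f (h y)) y v = (\<Sum>b\<in>Basis. fd f (h y) b * (fd h y v \<bullet> b))" if y: "y \<in> S" for y
  proof -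
    have hy: "h y \<in> T" using y T by blast
    have "fd (\<lambda>y. f (h y)) y v = fd f (h y) (fd h y v)"
      by (rule fd_eqI, rule has_derivative_compose[OF smooth_has_derivative[OF h y] smooth_has_derivative[OF f hy]])
    then show ?thesis using linear_expand[OF linear_fd[OF f hy], of "fd h y v"] by simp
  qed
  have d: "((\<lambda>y. \<Sum>b\<in>Basis. fd f (h y) b * (fd h y v \<bullet> b)) has_derivative
     (\<lambda>w. \<Sum>b\<in>Basis. fd f (h x) b * (hess h x v w \<bullet> b) + hess f (h x) b (fd h x w) * (fd h x v \<bullet> b))) (at x)"
  proof (intro has_derivative_sum has_derivative_mult)
    fix b
    show "((\<lambda>y. fd f (h y) b) has_derivative (\<lambda>w. hess f (h x) b (fd h x w))) (at x)"
      by (rule has_derivative_compose[OF smooth_has_derivative[OF h S(2)] smooth_hess[OF f hx]])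
    show "((\<lambda>y. fd h y v \<bullet> b) has_derivative (\<lambda>w. hess h x v w \<bullet> b)) (at x)"
      by (rule bounded_linear.has_derivative[OF bounded_linear_inner_left smooth_hess[OF h S(2)]])
  qed
  show ?thesis
  proof -
    have a: "fd f (h x) (hess h x v w) = (\<Sum>b\<in>Basis. fd f (h x) b * (hess h x v w \<bullet> b))"
      by (rule linear_expand[OF linear_fd[OF f hx]])
    have b: "hess f (h x) (fd h x v) (fd h x w) = (\<Sum>b\<in>Basis. hess f (h x) b (fd h x w) * (fd h x v \<bullet> b))"
      by (rule linear_expand[OF linear_hess_left[OF T(1) f hx]])
    have "hess (\<lambda>y. f (h y)) x v w = (\<Sum>b\<in>Basis. fd f (h x) b * (hess h x v w \<bullet> b)
        + hess f (h x) b (fd h x w) * (fd h x v \<bullet> b))"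
      by (rule hess_eqI[OF S _ d]) (rule e)
    then show ?thesis
      unfolding a b sum.distrib by simp
  qed
qed

text \<open>
  By \<open>hol_hess_i\<close> the terms with the second derivative of \<open>h\<close> cancel. This is the transformation law
  of the Levi form.
\<close>
lemma line_lap_holomorphic_comp:
  fixes f :: "complex ^ 'm::finite \<Rightarrow> real" and h :: "complex ^ 'n::finite \<Rightarrow> complex ^ 'm"
  assumes S: "open S" "x \<in> S" and T: "open T" "h ` S \<subseteq> T" and f: "smooth_on T f" and h: "holomorphic_map_on h S"
  shows "line_lap (\<lambda>y. f (h y)) x v = line_lap f (h x) (fd h x v)"
proof -
  have "linear (frechet_derivative f (at (h x)))" using linear_fd[OF f] S T by blast
  then show ?thesis
    unfolding line_lap_def hess_comp[OF S T f hol_smooth[OF h S(1)]] hol_hess_i[OF h S] hol_fd_scale[OF h S]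
    by (simp add: linear_neg)
qed

lemma smooth_strictly_psh_on_iff_line_lap:
  fixes u :: "complex ^ 'n::finite \<Rightarrow> real"
  assumes "open S"
  shows "smooth_strictly_psh_on S u \<longleftrightarrow> smooth_on S u \<and> (\<forall>z\<in>S. \<forall>v. v \<noteq> 0 \<longrightarrow> line_lap u z v > 0)"
  unfolding smooth_strictly_psh_on_def by (intro conj_cong ball_cong refl) (simp add: Re_levi_form[OF assms])

lemma smooth_on_cong:
  assumes "open S" "smooth_on S f" "\<And>x. x \<in> S \<Longrightarrow> f x = g x" shows "smooth_on S g"
  using assms Ck_on_cong unfolding smooth_on_def by blast

lemma smooth_on_subset: "smooth_on T f \<Longrightarrow> S \<subseteq> T \<Longrightarrow> smooth_on S f"
  unfolding smooth_on_def using Ck_on_subset by blast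

lemma smooth_strictly_psh_on_subset:
  "smooth_strictly_psh_on T u \<Longrightarrow> S \<subseteq> T \<Longrightarrow> smooth_strictly_psh_on S u"
  unfolding smooth_strictly_psh_on_def using smooth_on_subset by blast

lemma smooth_strictly_psh_on_cong:
  fixes u :: "complex ^ 'n::finite \<Rightarrow> real"
  assumes S: "open S" and u: "smooth_strictly_psh_on S u" and eq: "\<And>x. x \<in> S \<Longrightarrow> u x = w x"
  shows "smooth_strictly_psh_on S w"
proof -
  have "smooth_on S u" "\<And>z v. z \<in> S \<Longrightarrow> v \<noteq> 0 \<Longrightarrow> line_lap u z v > 0"
    using u unfolding smooth_strictly_psh_on_iff_line_lap[OF S] by auto
  moreover have "line_lap w z v = line_lap u z v" if "z \<in> S" for z v
    unfolding line_lap_def using hess_cong[OF S eq that] by simp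
  ultimately show ?thesis
    unfolding smooth_strictly_psh_on_iff_line_lap[OF S] using smooth_on_cong[OF S _ eq] by simp
qed

text \<open>
  The left inverse \<open>k\<close> makes the derivative of \<open>h\<close> injective, so that strictness is preserved.
\<close>
lemma smooth_strictly_psh_on_comp:
  fixes f :: "complex ^ 'm::finite \<Rightarrow> real" and h :: "complex ^ 'n::finite \<Rightarrow> complex ^ 'm"
  assumes S: "open S" and T: "open T" "h ` S \<subseteq> T" and f: "smooth_strictly_psh_on T f"
    and h: "holomorphic_map_on h S" and k: "holomorphic_map_on k T" "\<And>x. x \<in> S \<Longrightarrow> k (h x) = x"
  shows "smooth_strictly_psh_on S (\<lambda>x. f (h x))"
  unfolding smooth_strictly_psh_on_iff_line_lap[OF S]
proof (intro conjI ballI allI impI)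
  have f': "smooth_on T f" "\<And>z v. z \<in> T \<Longrightarrow> v \<noteq> 0 \<Longrightarrow> line_lap f z v > 0"
    using f unfolding smooth_strictly_psh_on_iff_line_lap[OF T(1)] by auto
  note hs = hol_smooth[OF h S] and ks = hol_smooth[OF k(1) T(1)]
  show "smooth_on S (\<lambda>x. f (h x))"
    unfolding smooth_on_def using Ck_on_comp[OF S T(2)] f'(1) hs by (auto simp: smooth_on_def)
  fix x v assume x: "x \<in> S" and v: "v \<noteq> (0 :: complex ^ 'n)"
  have hx: "h x \<in> T" using x T by blast
  have "((\<lambda>y. k (h y)) has_derivative (\<lambda>v. fd k (h x) (fd h x v))) (at x)"
    by (rule has_derivative_compose[OF smooth_has_derivative[OF hs x] smooth_has_derivative[OF ks hx]])
  moreover have "((\<lambda>y. k (h y)) has_derivative (\<lambda>v. v)) (at x)"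
    by (rule has_derivative_transform_within_open[OF has_derivative_ident S x]) (simp add: k(2))
  ultimately have "fd k (h x) (fd h x v) = v" using has_derivative_unique by metis
  then have "fd h x v \<noteq> 0" using v linear_0[OF linear_fd[OF ks hx]] by metis
  then show "line_lap (\<lambda>x. f (h x)) x v > 0"
    unfolding line_lap_holomorphic_comp[OF S x T f'(1) h] by (rule f'(2)[OF hx])
qed

section \<open>Strictly plurisubharmonic functions in a chart\<close>

lemma smooth_add: "open S \<Longrightarrow> smooth_on S f \<Longrightarrow> smooth_on S g \<Longrightarrow> smooth_on S (\<lambda>x. f x + g x)"
  unfolding smooth_on_def using Ck_on_add by blast

lemma smooth_cmult:
  fixes f :: "'a::real_normed_vector \<Rightarrow> real"
  shows "open S \<Longrightarrow> smooth_on S f \<Longrightarrow> smooth_on S (\<lambda>x. c * f x)"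
  unfolding smooth_on_def using Ck_on_cmult by blast

lemma smooth_strictly_psh_on_add:
  fixes f :: "complex ^ 'n::finite \<Rightarrow> real"
  assumes S: "open S" and f: "smooth_strictly_psh_on S f" and g: "smooth_on S g"
    and nonneg: "\<And>z v. z \<in> S \<Longrightarrow> line_lap g z v \<ge> 0"
  shows "smooth_strictly_psh_on S (\<lambda>z. f z + g z)"
proof -
  have f': "smooth_on S f" "\<And>z v. z \<in> S \<Longrightarrow> v \<noteq> 0 \<Longrightarrow> line_lap f z v > 0"
    using f unfolding smooth_strictly_psh_on_iff_line_lap[OF S] by auto
  have "line_lap (\<lambda>z. f z + g z) z v = line_lap f z v + line_lap g z v" if "z \<in> S" for z v
    unfolding line_lap_def by (simp add: hess_add[OF S f'(1) g that])
  then show ?thesis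
    unfolding smooth_strictly_psh_on_iff_line_lap[OF S]
    using smooth_add[OF S f'(1) g] f'(2) nonneg by (simp add: add_pos_nonneg)
qed

lemma smooth_const: "smooth_on S (\<lambda>x. c)"
  unfolding smooth_on_def using Ck_on_const by blast

lemma line_lap_const: "line_lap (\<lambda>x. c) z v = 0"
proof -
  have "fd (\<lambda>x. c) = (\<lambda>x v. 0)" by (auto simp: fun_eq_iff fd_eqI[OF has_derivative_const])
  then show ?thesis by (simp add: line_lap_def hess_def fd_eqI[OF has_derivative_const])
qed

lemma line_lap_dist_sq:
  fixes c :: "complex ^ 'n::finite"
  shows "line_lap (\<lambda>z. (z - c) \<bullet> (z - c)) z v = 4 * (norm v)\<^sup>2"
proof -
  have "hess (\<lambda>z. (z - c) \<bullet> (z - c)) z v v = 2 * (v \<bullet> v)" for z v :: "complex ^ 'n"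
  proof (rule hess_eqI[OF open_UNIV UNIV_I, where g = "\<lambda>y. 2 * (v \<bullet> (y - c))" and D = "\<lambda>w. 2 * (v \<bullet> w)"])
    fix y :: "complex ^ 'n"
    have "((\<lambda>z. (z - c) \<bullet> (z - c)) has_derivative (\<lambda>w. (y - c) \<bullet> w + w \<bullet> (y - c))) (at y)"
      by (auto intro!: derivative_eq_intros)
    from fd_eqI[OF this] show "fd (\<lambda>z. (z - c) \<bullet> (z - c)) y v = 2 * (v \<bullet> (y - c))"
      by (simp add: inner_commute)
  next
    show "((\<lambda>y. 2 * (v \<bullet> (y - c))) has_derivative (\<lambda>w. 2 * (v \<bullet> w))) (at z)"
      by (auto intro!: derivative_eq_intros)
  qed
  then show ?thesis by (simp add: line_lap_def dot_square_norm norm_complex_scale)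
qed

lemma continuous_on_line_lap:
  fixes f :: "complex ^ 'n::finite \<Rightarrow> real"
  assumes S: "open S" and f: "smooth_on S f"
  shows "continuous_on (S \<times> UNIV) (\<lambda>(z, v). line_lap f z v)"
proof -
  let ?H = "\<lambda>x v w. \<Sum>b\<in>Basis. \<Sum>b'\<in>Basis. hess f x b b' * (w \<bullet> b') * (v \<bullet> b)"
  have H: "hess f z v w = ?H z v w" if z: "z \<in> S" for z v w
  proof -
    have "hess f z v w = (\<Sum>b\<in>Basis. hess f z b w * (v \<bullet> b))"
      by (rule linear_expand[OF linear_hess_left[OF S f z]])
    moreover have "hess f z b w = (\<Sum>b'\<in>Basis. hess f z b b' * (w \<bullet> b'))" for b
      by (rule linear_expand[OF linear_hess_right[OF f z]])
    ultimately show ?thesis by (simp add: sum_distrib_right)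
  qed
  have c: "continuous_on (S \<times> UNIV) (\<lambda>x. hess f (fst x) b b')" for b b'
    by (rule continuous_on_compose2[OF continuous_hess[OF f] continuous_on_fst[OF continuous_on_id]]) auto
  have "continuous_on (S \<times> UNIV) (\<lambda>x. ?H (fst x) (snd x) (snd x) + ?H (fst x) (\<i> *s snd x) (\<i> *s snd x))"
    by (intro continuous_on_add continuous_on_sum continuous_on_mult c continuous_on_inner continuous_on_const
        continuous_on_complex_scale continuous_on_snd continuous_on_id)
  then show ?thesis
    by (rule continuous_on_eq) (auto simp: line_lap_def H)
qed

text \<open>
  By compactness of a ball times the unit sphere, the Laplacians along unit directions have a positive
  lower bound \<open>m\<close>, while those of the squared distance equal \<open>4\<close>.
\<close>
lemma strictly_psh_perturb:
  fixes f :: "complex ^ 'n::finite \<Rightarrow> real"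
  assumes T: "open T" "c \<in> T" and f: "smooth_strictly_psh_on T f"
  obtains R \<delta> where "R > 0" "\<delta> > 0" "cball c R \<subseteq> T"
    "smooth_strictly_psh_on (ball c R) (\<lambda>z. f z + (- \<delta>) * ((z - c) \<bullet> (z - c)))"
proof -
  have f': "smooth_on T f" "\<And>z v. z \<in> T \<Longrightarrow> v \<noteq> 0 \<Longrightarrow> line_lap f z v > 0"
    using f unfolding smooth_strictly_psh_on_iff_line_lap[OF T(1)] by auto
  obtain R where R: "R > 0" "cball c R \<subseteq> T" using T open_contains_cball by blast
  let ?K = "cball c R \<times> (sphere 0 1 :: (complex ^ 'n) set)"
  have "compact ?K" by (intro compact_Times) auto
  moreover have "?K \<noteq> {}" using R(1) vector_choose_size[of 1] by (auto simp: dist_norm)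
  moreover have "continuous_on ?K (\<lambda>(z, v). line_lap f z v)"
    by (rule continuous_on_subset[OF continuous_on_line_lap[OF T(1) f'(1)]]) (use R(2) in auto)
  ultimately obtain x where x: "x \<in> ?K" "\<forall>y\<in>?K. (\<lambda>(z, v). line_lap f z v) x \<le> (\<lambda>(z, v). line_lap f z v) y"
    using continuous_attains_inf by metis
  define m where "m = (\<lambda>(z, v). line_lap f z v) x"
  have m: "m > 0"
  proof -
    obtain z v where zv: "x = (z, v)" by (cases x)
    then have "z \<in> T" "v \<noteq> 0" using x(1) R(2) by auto
    then show ?thesis using f'(2) by (simp add: m_def zv)
  qed
  have lower: "line_lap f z v \<ge> m * (norm v)\<^sup>2" if z: "z \<in> cball c R" and v: "v \<noteq> 0" for z v
  proof -
    define v0 where "v0 = inverse (norm v) *\<^sub>R v"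
    have "(z, v0) \<in> ?K" using z v by (simp add: v0_def)
    then have "m \<le> line_lap f z v0" using x(2) unfolding m_def by fastforce
    moreover have "v = of_real (norm v) *s v0" using v by (simp add: complex_scale_of_real v0_def)
    then have "line_lap f z v = (norm v)\<^sup>2 * line_lap f z v0"
      using line_lap_scale[OF T(1) f'(1), of z "norm v" v0] z R(2) by auto
    ultimately show ?thesis
      using mult_right_mono[of m "line_lap f z v0" "(norm v)\<^sup>2"] by (simp add: mult.commute)
  qed
  define \<delta> where "\<delta> = m / 8"
  let ?Q = "\<lambda>z :: complex ^ 'n. (z - c) \<bullet> (z - c)"
  have Q: "smooth_on (ball c R) ?Q" using smooth_dist_sq smooth_on_subset by blast
  have fB: "smooth_on (ball c R) f"
    by (rule smooth_on_subset[OF f'(1)]) (use R(2) in auto)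
  have "smooth_strictly_psh_on (ball c R) (\<lambda>z. f z + (- \<delta>) * ?Q z)"
    unfolding smooth_strictly_psh_on_iff_line_lap[OF open_ball]
  proof (intro conjI ballI allI impI)
    show "smooth_on (ball c R) (\<lambda>z. f z + (- \<delta>) * ?Q z)"
      by (intro smooth_add smooth_cmult fB Q open_ball)
    fix z v assume z: "z \<in> ball c R" and v: "v \<noteq> (0 :: complex ^ 'n)"
    have "line_lap (\<lambda>z. f z + (- \<delta>) * ?Q z) z v = line_lap f z v + (- \<delta>) * line_lap ?Q z v"
      unfolding line_lap_def hess_add[OF open_ball fB smooth_cmult[OF open_ball Q] z] hess_cmult[OF open_ball Q z]
      by (simp add: algebra_simps)
    also have "\<dots> \<ge> m * (norm v)\<^sup>2 / 2"
      using lower[of z v] z v unfolding line_lap_dist_sq by (simp add: \<delta>_def)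
    finally show "line_lap (\<lambda>z. f z + (- \<delta>) * ?Q z) z v > 0"
      using m v by (smt (verit) divide_pos_pos mult_pos_pos zero_less_norm_iff zero_less_power)
  qed
  then show ?thesis using that[of R \<delta>] R m by (simp add: \<delta>_def)
qed

lemma psh_on_combine:
  assumes u: "continuous_on S u" "psh_on S u" and w: "continuous_on S w" "psh_on S w" and ab: "a \<ge> 0" "b \<ge> 0"
  shows "psh_on S (\<lambda>z. a * u z + b * w z + c)"
proof -
  have cont: "continuous_on S (\<lambda>z. a * u z + b * w z + c)"
    by (intro continuous_intros u w)
  show ?thesis
    unfolding psh_on_continuous_iff[OF cont]
  proof (intro allI impI)
    fix z v assume disc: "\<forall>\<zeta>. cmod \<zeta> \<le> 1 \<longrightarrow> z + \<zeta> *s v \<in> S"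
    let ?I = "\<lambda>f. integral {0..2 * pi} (\<lambda>t. f (z + cis t *s v))"
    have int: "(\<lambda>t. f (z + cis t *s v)) integrable_on {0..2 * pi}" if "continuous_on S f" for f :: "complex ^ 'a \<Rightarrow> real"
      by (rule integrable_continuous_real, rule continuous_on_compose2[OF that])
        (use disc in \<open>auto intro!: continuous_intros\<close>)
    have "((\<lambda>t. a * u (z + cis t *s v) + b * w (z + cis t *s v) + c) has_integral
        a * ?I u + b * ?I w + (2 * pi - 0) *\<^sub>R c) {0..2 * pi}"
      by (intro has_integral_add has_integral_mult_right integrable_integral int u w)
        (use has_integral_const_real[of c 0 "2 * pi"] in simp)
    then have I: "?I (\<lambda>z. a * u z + b * w z + c) = a * ?I u + b * ?I w + 2 * pi * c"
      by (simp add: integral_unique)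
    have "u z \<le> ?I u / (2 * pi)" "w z \<le> ?I w / (2 * pi)"
      using u(2) w(2) disc unfolding psh_on_continuous_iff[OF u(1)] psh_on_continuous_iff[OF w(1)]
      by blast+
    then have "a * u z \<le> a * (?I u / (2 * pi))" "b * w z \<le> b * (?I w / (2 * pi))"
      using mult_left_mono[OF _ ab(1)] mult_left_mono[OF _ ab(2)] by blast+
    then show "a * u z + b * w z + c \<le> ?I (\<lambda>z. a * u z + b * w z + c) / (2 * pi)"
      unfolding I by (simp add: add_divide_distrib)
  qed
qed

lemma psh_on_max:
  assumes S: "open S" and u: "continuous_on S u" "psh_on S u" and w: "continuous_on S w" "psh_on S w"
  shows "psh_on S (\<lambda>z. max (u z) (w z))"
proof (rule psh_onI[OF S])
  show "continuous_on S (\<lambda>z. max (u z) (w z))" by (intro continuous_on_max u w)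
  fix z a v assume x: "z + a *s v \<in> S"
  show "subh_at (\<lambda>\<zeta>. max (u (z + \<zeta> *s v)) (w (z + \<zeta> *s v))) a"
  proof (cases "u (z + a *s v) \<ge> w (z + a *s v)")
    case True
    then show ?thesis by (intro subh_at_mono[OF psh_on_subh_at[OF S u(2) x]]) auto
  next
    case False
    then show ?thesis by (intro subh_at_mono[OF psh_on_subh_at[OF S w(2) x]]) auto
  qed
qed

section \<open>Gluing on the manifold\<close>

context complex_manifold
begin

lemma chartD:
  assumes "(U, \<phi>) \<in> atlas"
  shows "open U" "open (\<phi> ` U)" "continuous_on U \<phi>" "continuous_on (\<phi> ` U) (inv_into U \<phi>)" "inj_on \<phi> U"
    and "\<And>x. x \<in> U \<Longrightarrow> inv_into U \<phi> (\<phi> x) = x"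
proof -
  have *: "open U" "open (\<phi> ` U)" "homeomorphism U (\<phi> ` U) \<phi> (inv_into U \<phi>)"
    using charts[OF assms] unfolding is_chart_def by auto
  then show "open U" "open (\<phi> ` U)" "continuous_on U \<phi>" "continuous_on (\<phi> ` U) (inv_into U \<phi>)"
      "\<And>x. x \<in> U \<Longrightarrow> inv_into U \<phi> (\<phi> x) = x"
    by (auto simp: homeomorphism_def)
  then show "inj_on \<phi> U" by (metis inj_onI)
qed

lemma chart_image_open:
  assumes "(U, \<phi>) \<in> atlas" "open W" shows "open (\<phi> ` (U \<inter> W))"
proof -
  have "\<phi> ` (U \<inter> W) = \<phi> ` U \<inter> inv_into U \<phi> -` W"
  proof (intro equalityI subsetI)
    fix y assume "y \<in> \<phi> ` U \<inter> inv_into U \<phi> -` W"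
    then obtain x where "x \<in> U" "y = \<phi> x" "inv_into U \<phi> (\<phi> x) \<in> W" by blast
    then show "y \<in> \<phi> ` (U \<inter> W)" using chartD(6)[OF assms(1)] by auto
  qed (use chartD(6)[OF assms(1)] in auto)
  then show ?thesis
    using continuous_open_preimage[OF chartD(4,2)[OF assms(1)] assms(2)] by simp
qed

lemma chart_preimage_open: "(U, \<phi>) \<in> atlas \<Longrightarrow> open A \<Longrightarrow> open (U \<inter> \<phi> -` A)"
  by (rule continuous_open_preimage[OF chartD(3,1)])

lemma chart_preimage_compact:
  assumes "(U, \<phi>) \<in> atlas" "compact C" "C \<subseteq> \<phi> ` U" shows "compact (U \<inter> \<phi> -` C)"
proof -
  have "U \<inter> \<phi> -` C = inv_into U \<phi> ` C"
  proof (intro equalityI subsetI)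
    fix x assume "x \<in> U \<inter> \<phi> -` C"
    then show "x \<in> inv_into U \<phi> ` C" using chartD(6)[OF assms(1), of x] by (intro image_eqI[of _ _ "\<phi> x"]) auto
  next
    fix x assume "x \<in> inv_into U \<phi> ` C"
    then obtain y where y: "y \<in> C" "x = inv_into U \<phi> y" by blast
    then have "y \<in> \<phi> ` U" using assms(3) by blast
    then show "x \<in> U \<inter> \<phi> -` C" using y by (simp add: inv_into_into f_inv_into_f)
  qed
  then show ?thesis
    using compact_continuous_image[OF continuous_on_subset[OF chartD(4)[OF assms(1)] assms(3)] assms(2)] by simp
qed

lemma chart_at: obtains U \<phi> where "(U, \<phi>) \<in> atlas" "x \<in> U"
proof -
  have "x \<in> (\<Union>(U, \<phi>)\<in>atlas. U)" using covering by simp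
  then show ?thesis by (auto intro: that)
qed

text \<open>
  The passage from one chart to all charts. The set \<open>W\<close> has to lie in the chart domain.
\<close>
lemma strictly_psh_of_chart:
  assumes c: "(U, \<phi>) \<in> atlas" and W: "open W" "W \<subseteq> U"
    and f: "smooth_strictly_psh_on (\<phi> ` W) f" and g: "\<And>x. x \<in> W \<Longrightarrow> g x = f (\<phi> x)"
  shows "smooth_strictly_plurisubharmonic_on W g"
  unfolding smooth_strictly_plurisubharmonic_on_def
proof safe
  fix V \<psi> assume d: "(V, \<psi>) \<in> atlas"
  let ?S = "\<psi> ` (V \<inter> W)" and ?T = "\<phi> ` (U \<inter> (V \<inter> W))"
  let ?h = "\<phi> \<circ> inv_into V \<psi>" and ?k = "\<psi> \<circ> inv_into U \<phi>"
  have S: "open ?S" by (rule chart_image_open[OF d W(1)])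
  have T: "open ?T" using chart_image_open[OF c] chartD(1)[OF d] W(1) by auto
  have "smooth_strictly_psh_on ?S (\<lambda>x. f (?h x))"
  proof (rule smooth_strictly_psh_on_comp[OF S T])
    show "?h ` ?S \<subseteq> ?T" using chartD(6)[OF d] W(2) by auto
    show "smooth_strictly_psh_on ?T f" by (rule smooth_strictly_psh_on_subset[OF f]) auto
    show "holomorphic_map_on ?h ?S"
      using holomorphic_transition[OF d c] W(2) unfolding holomorphic_map_on_def by blast
    show "holomorphic_map_on ?k ?T"
      using holomorphic_transition[OF c d] W(2) unfolding holomorphic_map_on_def by blast
    show "?k (?h x) = x" if "x \<in> ?S" for x
      using that chartD(6)[OF d] chartD(6)[OF c] W(2) by auto
  qed
  then show "smooth_strictly_psh_on ?S (g \<circ> inv_into V \<psi>)"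
    by (rule smooth_strictly_psh_on_cong[OF S]) (use g chartD(6)[OF d] in auto)
qed

lemma strictly_psh_in_chart:
  "smooth_strictly_plurisubharmonic_on W u \<Longrightarrow> (U, \<phi>) \<in> atlas \<Longrightarrow>
    smooth_strictly_psh_on (\<phi> ` (U \<inter> W)) (u \<circ> inv_into U \<phi>)"
  unfolding smooth_strictly_plurisubharmonic_on_def by blast

lemma strictly_psh_continuous:
  assumes "smooth_strictly_plurisubharmonic_on W u" "open W"
  shows "continuous_on W u"
  unfolding continuous_on_eq_continuous_at[OF assms(2)]
proof
  fix x assume x: "x \<in> W"
  obtain U \<phi> where c: "(U, \<phi>) \<in> atlas" "x \<in> U" by (rule chart_at)
  have "continuous_on (\<phi> ` (U \<inter> W)) (u \<circ> inv_into U \<phi>)"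
    using strictly_psh_in_chart[OF assms(1) c(1)] smooth_continuous unfolding smooth_strictly_psh_on_def by blast
  moreover have "continuous_on (U \<inter> W) \<phi>" using chartD(3)[OF c(1)] continuous_on_subset by blast
  ultimately have "continuous_on (U \<inter> W) (\<lambda>x. (u \<circ> inv_into U \<phi>) (\<phi> x))"
    by (rule continuous_on_compose2) simp
  then have "continuous_on (U \<inter> W) u"
    by (rule continuous_on_eq) (use chartD(6)[OF c(1)] in auto)
  then show "isCont u x"
    using x c(2) chartD(1)[OF c(1)] assms(2) by (simp add: continuous_on_eq_continuous_at open_Int)
qed

lemma PSH_cbD:
  assumes "u \<in> PSH_cb"
  shows "continuous_on A u" "bounded (range u)"
    and "(U, \<phi>) \<in> atlas \<Longrightarrow> psh_on (\<phi> ` U) (u \<circ> inv_into U \<phi>)"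
    and "(U, \<phi>) \<in> atlas \<Longrightarrow> continuous_on (\<phi> ` U) (u \<circ> inv_into U \<phi>)"
proof -
  show u: "continuous_on A u" for A
    using assms continuous_on_subset unfolding PSH_cb_def by blast
  show "bounded (range u)" using assms unfolding PSH_cb_def by blast
  show "psh_on (\<phi> ` U) (u \<circ> inv_into U \<phi>)" if "(U, \<phi>) \<in> atlas"
    using assms that unfolding PSH_cb_def plurisubharmonic_def by blast
  show "continuous_on (\<phi> ` U) (u \<circ> inv_into U \<phi>)" if "(U, \<phi>) \<in> atlas"
    by (rule continuous_on_compose[OF chartD(4)[OF that] u])
qed

lemma PSH_cbI:
  assumes "continuous_on UNIV u" "bounded (range u)"
    and "\<And>U \<phi>. (U, \<phi>) \<in> atlas \<Longrightarrow> psh_on (\<phi> ` U) (u \<circ> inv_into U \<phi>)"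
  shows "u \<in> PSH_cb"
  using assms unfolding PSH_cb_def plurisubharmonic_def by auto

lemma PSH_cb_const: "(\<lambda>x. c) \<in> PSH_cb"
proof (rule PSH_cbI)
  show "psh_on (\<phi> ` U) ((\<lambda>x. c) \<circ> inv_into U \<phi>)" for U and \<phi> :: "'a \<Rightarrow> complex ^ 'n"
    using psh_on_continuous_iff[of "\<phi> ` U" "\<lambda>x. c"] by (simp add: o_def)
qed auto

lemma PSH_cb_combine:
  assumes u: "u \<in> PSH_cb" and w: "w \<in> PSH_cb" and ab: "a \<ge> 0" "b \<ge> 0"
  shows "(\<lambda>x. a * u x + b * w x + c) \<in> PSH_cb"
proof (rule PSH_cbI)
  show "continuous_on UNIV (\<lambda>x. a * u x + b * w x + c)" by (intro continuous_intros PSH_cbD(1) u w)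
  obtain M1 M2 where M: "\<And>x. \<bar>u x\<bar> \<le> M1" "\<And>x. \<bar>w x\<bar> \<le> M2"
    using PSH_cbD(2)[OF u] PSH_cbD(2)[OF w] unfolding bounded_iff by auto
  have "\<bar>a * u x + b * w x + c\<bar> \<le> a * M1 + b * M2 + \<bar>c\<bar>" for x
  proof -
    have "\<bar>a * u x\<bar> \<le> a * M1" "\<bar>b * w x\<bar> \<le> b * M2"
      using M ab by (auto simp: abs_mult mult_left_mono)
    then show ?thesis by linarith
  qed
  then show "bounded (range (\<lambda>x. a * u x + b * w x + c))" unfolding bounded_iff by auto
  show "psh_on (\<phi> ` U) ((\<lambda>x. a * u x + b * w x + c) \<circ> inv_into U \<phi>)" if "(U, \<phi>) \<in> atlas" for U \<phi>
    using psh_on_combine[OF PSH_cbD(4,3)[OF u that] PSH_cbD(4,3)[OF w that] ab, of c] that by (simp add: o_def)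
qed

lemma PSH_cb_max:
  assumes u: "u \<in> PSH_cb" and w: "w \<in> PSH_cb"
  shows "(\<lambda>x. max (u x) (w x)) \<in> PSH_cb"
proof (rule PSH_cbI)
  show "continuous_on UNIV (\<lambda>x. max (u x) (w x))" by (intro continuous_on_max PSH_cbD(1) u w)
  obtain M1 M2 where M: "\<And>x. \<bar>u x\<bar> \<le> M1" "\<And>x. \<bar>w x\<bar> \<le> M2"
    using PSH_cbD(2)[OF u] PSH_cbD(2)[OF w] unfolding bounded_iff by auto
  have "\<bar>max (u x) (w x)\<bar> \<le> max M1 M2" for x using M[of x] by linarith
  then show "bounded (range (\<lambda>x. max (u x) (w x)))" unfolding bounded_iff by auto
  show "psh_on (\<phi> ` U) ((\<lambda>x. max (u x) (w x)) \<circ> inv_into U \<phi>)" if "(U, \<phi>) \<in> atlas" for U \<phi>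
    using psh_on_max[OF chartD(2)[OF that] PSH_cbD(4,3)[OF u that] PSH_cbD(4,3)[OF w that]] that by (simp add: o_def)
qed

text \<open>
  At each point one of \<open>A\<close> and \<open>B\<close> touches the glued function from below, and \<open>subh_at\<close> passes
  upwards at a point of contact (\<open>subh_at_mono\<close>). Since the function equals \<open>A\<close> off the compact set
  \<open>K\<close>, it is continuous across the boundary of \<open>\<Omega>\<close> and bounded.
\<close>
lemma PSH_cb_glue:
  assumes A: "A \<in> PSH_cb" and \<Omega>: "open \<Omega>" and B: "smooth_strictly_plurisubharmonic_on \<Omega> B"
    and K: "compact K" "K \<subseteq> \<Omega>" and le: "\<And>x. x \<in> \<Omega> \<Longrightarrow> x \<notin> K \<Longrightarrow> B x \<le> A x"
  shows "(\<lambda>x. if x \<in> \<Omega> then max (A x) (B x) else A x) \<in> PSH_cb" (is "?F \<in> _")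
proof -
  have B_cont: "continuous_on \<Omega> B" by (rule strictly_psh_continuous[OF B \<Omega>])
  have cont: "continuous_on UNIV ?F"
  proof -
    have "continuous_on \<Omega> ?F"
      by (rule continuous_on_eq[OF continuous_on_max[OF PSH_cbD(1)[OF A] B_cont]]) auto
    moreover have "continuous_on (- K) ?F"
      by (rule continuous_on_eq[OF PSH_cbD(1)[OF A]]) (use le in \<open>auto simp: max_def intro: antisym\<close>)
    moreover have "open (- K)" using compact_imp_closed[OF K(1)] by auto
    ultimately have "continuous_on (\<Omega> \<union> - K) ?F" using \<Omega> by (intro continuous_on_open_Un)
    moreover have "\<Omega> \<union> - K = UNIV" using K(2) by auto
    ultimately show ?thesis by simp
  qed
  have bdd: "bounded (range ?F)"
  proof -
    obtain M where M: "\<And>x. \<bar>A x\<bar> \<le> M"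
      using PSH_cbD(2)[OF A] unfolding bounded_iff by auto
    have "bounded (B ` K)"
      by (rule compact_imp_bounded[OF compact_continuous_image[OF continuous_on_subset[OF B_cont K(2)] K(1)]])
    then obtain N where N: "\<And>x. x \<in> K \<Longrightarrow> \<bar>B x\<bar> \<le> N"
      unfolding bounded_iff by auto
    have "\<bar>?F x\<bar> \<le> max M N" for x
    proof (cases "x \<in> K")
      case True
      then show ?thesis using M[of x] N[of x] by auto
    next
      case False
      then have "?F x = A x" using le by (auto simp: max_def intro: antisym)
      then show ?thesis using M[of x] by simp
    qed
    then have "norm y \<le> max M N" if "y \<in> range ?F" for y
      using that unfolding real_norm_def by blast
    then show ?thesis by (rule boundedI)
  qed
  have psh: "psh_on (\<phi> ` U) (?F \<circ> inv_into U \<phi>)" if c: "(U, \<phi>) \<in> atlas" for U \<phi>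
  proof (rule psh_onI[OF chartD(2)[OF c]])
    show "continuous_on (\<phi> ` U) (?F \<circ> inv_into U \<phi>)"
      by (rule continuous_on_compose[OF chartD(4)[OF c] continuous_on_subset[OF cont subset_UNIV]])
    fix z a v assume x: "z + a *s v \<in> \<phi> ` U"
    let ?g = "inv_into U \<phi>"
    show "subh_at (\<lambda>\<zeta>. (?F \<circ> ?g) (z + \<zeta> *s v)) a"
    proof (cases "?F (?g (z + a *s v)) = A (?g (z + a *s v))")
      case True
      show ?thesis
        by (rule subh_at_mono[OF psh_on_subh_at[OF chartD(2)[OF c] PSH_cbD(3)[OF A c] x]])
          (use True in auto)
    next
      case False
      let ?S = "\<phi> ` (U \<inter> \<Omega>)"
      have S: "open ?S" by (rule chart_image_open[OF c \<Omega>])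
      have B': "smooth_on ?S (B \<circ> ?g)" "\<And>z v. z \<in> ?S \<Longrightarrow> v \<noteq> 0 \<Longrightarrow> line_lap (B \<circ> ?g) z v > 0"
        using strictly_psh_in_chart[OF B c] unfolding smooth_strictly_psh_on_iff_line_lap[OF S] by auto
      have in\<Omega>: "?g (z + a *s v) \<in> \<Omega>" and FB: "?F (?g (z + a *s v)) = B (?g (z + a *s v))"
        using False by (auto simp: max_def split: if_splits)
      have xS: "z + a *s v \<in> ?S"
      proof -
        obtain y where y: "y \<in> U" "z + a *s v = \<phi> y" using x by blast
        then show ?thesis using in\<Omega> chartD(6)[OF c] by auto
      qed
      have "line_lap (B \<circ> ?g) (z + a *s v) v \<ge> 4 * 0"
      proof (cases "v = 0")
        case True
        have "line_lap (B \<circ> ?g) y 0 = 0" if "y \<in> ?S" for y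
          unfolding line_lap_def using linear_0[OF linear_hess_right[OF B'(1) that]] by simp
        then show ?thesis using True xS by simp
      qed (use B'(2)[OF xS, of v] in simp)
      from subh_at_line_lap[OF S B'(1) xS this]
      have "subh_at (\<lambda>\<zeta>. (B \<circ> ?g) (z + \<zeta> *s v)) a" by simp
      then show ?thesis
      proof (rule subh_at_mono)
        show "(B \<circ> ?g) (z + a *s v) = (?F \<circ> ?g) (z + a *s v)" using FB by simp
        have "isCont (\<lambda>\<zeta>. z + \<zeta> *s v) a"
          using continuous_on_complex_line[OF continuous_on_id, of UNIV v]
          by (intro continuous_add continuous_const) (simp add: continuous_on_eq_continuous_at)
        then have "((\<lambda>\<zeta>. z + \<zeta> *s v) \<longlongrightarrow> z + a *s v) (nhds a)"
          by (simp add: continuous_at tendsto_nhds_iff)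
        then have "\<forall>\<^sub>F \<zeta> in nhds a. z + \<zeta> *s v \<in> ?S"
          using topological_tendstoD S xS by blast
        then show "\<forall>\<^sub>F \<zeta> in nhds a. (B \<circ> ?g) (z + \<zeta> *s v) \<le> (?F \<circ> ?g) (z + \<zeta> *s v)"
        proof eventually_elim
          case (elim \<zeta>)
          then have "?g (z + \<zeta> *s v) \<in> \<Omega>" using chartD(6)[OF c] by auto
          then show ?case by simp
        qed
      qed
    qed
  qed
  show ?thesis by (rule PSH_cbI[OF cont bdd psh])
qed

section \<open>The classes of points that are not separated\<close>

text \<open>
  If \<open>u\<close> itself does not separate the two points, then raising it by a small bump at \<open>w\<close> does.
\<close>
lemma not_core_separated:
  assumes w: "w \<notin> core" and ne: "w \<noteq> z0"
  shows "\<exists>u\<in>PSH_cb. u w \<noteq> u z0"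
proof -
  obtain u W where u: "u \<in> PSH_cb" and W: "open W" "w \<in> W" "smooth_strictly_plurisubharmonic_on W u"
    using w unfolding core_def by blast
  obtain U \<phi> where c: "(U, \<phi>) \<in> atlas" "w \<in> U" by (rule chart_at)
  let ?W = "W \<inter> - {z0}"
  have W': "open ?W" using W by (intro open_Int) auto
  let ?T = "\<phi> ` (U \<inter> ?W)" and ?f = "u \<circ> inv_into U \<phi>"
  have T: "open ?T" "\<phi> w \<in> ?T" using chart_image_open[OF c(1) W'] c W ne by auto
  have f: "smooth_strictly_psh_on ?T ?f"
    by (rule smooth_strictly_psh_on_subset[OF strictly_psh_in_chart[OF W(3) c(1)]]) auto
  obtain R \<delta> where R: "R > 0" "\<delta> > 0" "cball (\<phi> w) R \<subseteq> ?T"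
    and f\<delta>: "smooth_strictly_psh_on (ball (\<phi> w) R) (\<lambda>z. ?f z + (- \<delta>) * ((z - \<phi> w) \<bullet> (z - \<phi> w)))"
    using strictly_psh_perturb[OF T f] by blast
  define \<Omega> where "\<Omega> = U \<inter> \<phi> -` ball (\<phi> w) R"
  define K where "K = U \<inter> \<phi> -` cball (\<phi> w) (R / 2)"
  \<comment> \<open>\<open>B - u\<close> is positive at \<open>w\<close> and nonpositive outside the ball of radius \<open>R / 2\<close>.\<close>
  define B where "B x = ?f (\<phi> x) + (- \<delta>) * ((\<phi> x - \<phi> w) \<bullet> (\<phi> x - \<phi> w)) + \<delta> * (R / 2)\<^sup>2" for x
  have \<Omega>: "open \<Omega>" "\<Omega> \<subseteq> U" unfolding \<Omega>_def using chart_preimage_open[OF c(1)] by auto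
  have "cball (\<phi> w) (R / 2) \<subseteq> cball (\<phi> w) R" using R(1) by (intro subset_cball) simp
  then have "cball (\<phi> w) (R / 2) \<subseteq> \<phi> ` U" using R(3) by blast
  then have K: "compact K" unfolding K_def by (rule chart_preimage_compact[OF c(1) compact_cball])
  have K\<Omega>: "K \<subseteq> \<Omega>" using R(1) by (auto simp: K_def \<Omega>_def)
  have "smooth_strictly_plurisubharmonic_on \<Omega> B"
  proof (rule strictly_psh_of_chart[OF c(1) \<Omega>])
    have "smooth_strictly_psh_on (ball (\<phi> w) R) (\<lambda>z. ?f z + (- \<delta>) * ((z - \<phi> w) \<bullet> (z - \<phi> w)) + \<delta> * (R / 2)\<^sup>2)"
      by (rule smooth_strictly_psh_on_add[OF open_ball f\<delta> smooth_const]) (simp add: line_lap_const)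
    then show "smooth_strictly_psh_on (\<phi> ` \<Omega>) (\<lambda>z. ?f z + (- \<delta>) * ((z - \<phi> w) \<bullet> (z - \<phi> w)) + \<delta> * (R / 2)\<^sup>2)"
      by (rule smooth_strictly_psh_on_subset) (auto simp: \<Omega>_def)
  qed (simp add: B_def)
  moreover have "B x \<le> u x" if "x \<in> \<Omega>" "x \<notin> K" for x
  proof -
    have "R / 2 \<le> norm (\<phi> x - \<phi> w)" using that by (auto simp: \<Omega>_def K_def dist_norm norm_minus_commute)
    then have "(R / 2)\<^sup>2 \<le> (\<phi> x - \<phi> w) \<bullet> (\<phi> x - \<phi> w)"
      unfolding dot_square_norm using R(1) by (intro power_mono) auto
    then have "\<delta> * (R / 2)\<^sup>2 \<le> \<delta> * ((\<phi> x - \<phi> w) \<bullet> (\<phi> x - \<phi> w))" using R(2) by (intro mult_left_mono) auto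
    moreover have "?f (\<phi> x) = u x" using that \<Omega>(2) chartD(6)[OF c(1)] by auto
    ultimately show ?thesis unfolding B_def by linarith
  qed
  ultimately have F: "(\<lambda>x. if x \<in> \<Omega> then max (u x) (B x) else u x) \<in> PSH_cb" (is "?F \<in> _")
    by (intro PSH_cb_glue[OF u \<Omega>(1) _ K K\<Omega>])
  have "w \<in> \<Omega>" using c(2) R(1) by (simp add: \<Omega>_def)
  moreover have "B w = u w + \<delta> * (R / 2)\<^sup>2" using chartD(6)[OF c] by (simp add: B_def)
  moreover have "\<delta> * (R / 2)\<^sup>2 > 0" using R by simp
  ultimately have Fw: "?F w > u w" by simp
  have "z0 \<notin> \<Omega>"
  proof
    assume z: "z0 \<in> \<Omega>"
    then have "\<phi> z0 \<in> ?T" using R(3) by (auto simp: \<Omega>_def less_imp_le subset_iff)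
    then show False using z \<Omega>(2) chartD(5)[OF c(1)] by (auto dest: inj_onD)
  qed
  then have Fz: "?F z0 = u z0" by simp
  show ?thesis
  proof (cases "u w = u z0")
    case True
    then have "?F w \<noteq> ?F z0" using Fw Fz by linarith
    then show ?thesis using F by (rule bexI)
  next
    case False
    then show ?thesis using u by (rule bexI)
  qed
qed

text \<open>
  For a single point the difference is \<open>\<bar>u - u z0\<bar>\<close>; a finite subcover and addition give the general
  case. Differences have to be allowed because each function of \<open>PSH_cb\<close> that separates a point of
  \<open>K\<close> from \<open>z0\<close> may be smaller at that point.
\<close>
lemma separating_difference:
  assumes K: "compact K" and sep: "\<And>x. x \<in> K \<Longrightarrow> \<exists>u\<in>PSH_cb. u x \<noteq> u z0"
  shows "\<exists>a\<in>PSH_cb. \<exists>b\<in>PSH_cb. a z0 = b z0 \<and> (\<forall>x. b x \<le> a x) \<and> (\<forall>x\<in>K. b x < a x)"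
proof -
  define P where "P X \<longleftrightarrow> (\<exists>a\<in>PSH_cb. \<exists>b\<in>PSH_cb. a z0 = b z0 \<and> (\<forall>x. b x \<le> a x) \<and> (\<forall>x\<in>X. b x < a x))" for X
  have empty: "P {}" unfolding P_def using PSH_cb_const[of 0] by auto
  have union: "P (X \<union> Y)" if X: "P X" and Y: "P Y" for X Y
  proof -
    obtain a b where ab: "a \<in> PSH_cb" "b \<in> PSH_cb" "a z0 = b z0" "\<forall>x. b x \<le> a x" "\<forall>x\<in>X. b x < a x"
      using X unfolding P_def by blast
    obtain a' b' where ab': "a' \<in> PSH_cb" "b' \<in> PSH_cb" "a' z0 = b' z0" "\<forall>x. b' x \<le> a' x" "\<forall>x\<in>Y. b' x < a' x"
      using Y unfolding P_def by blast
    have "(\<lambda>x. 1 * a x + 1 * a' x + 0) \<in> PSH_cb" "(\<lambda>x. 1 * b x + 1 * b' x + 0) \<in> PSH_cb"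
      by (intro PSH_cb_combine ab ab' zero_le_one)+
    then show ?thesis
      unfolding P_def using ab ab'
      by (intro bexI[of _ "\<lambda>x. 1 * a x + 1 * a' x + 0"] bexI[of _ "\<lambda>x. 1 * b x + 1 * b' x + 0"])
        (auto intro: add_mono add_less_le_mono add_le_less_mono)
  qed
  have local: "\<exists>V. open V \<and> x \<in> V \<and> P V" if x: "x \<in> K" for x
  proof -
    obtain u where u: "u \<in> PSH_cb" "u x \<noteq> u z0" using sep x by blast
    let ?V = "{y. u y \<noteq> u z0}"
    have "open ?V" by (intro open_Collect_neq PSH_cbD(1) u continuous_on_const)
    moreover have "P ?V"
    proof -
      \<comment> \<open>\<open>2 max (u, c) - (u + c) = \<bar>u - c\<bar>\<close> with \<open>c = u z0\<close>\<close>
      have "(\<lambda>y. 2 * max (u y) (u z0) + 0 * u y + 0) \<in> PSH_cb"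
        using PSH_cb_combine[OF PSH_cb_max[OF u(1) PSH_cb_const] u(1), of 2 0 "u z0" 0] by simp
      moreover have "(\<lambda>y. 1 * u y + 0 * u y + u z0) \<in> PSH_cb"
        by (rule PSH_cb_combine[OF u(1) u(1)]) auto
      ultimately show ?thesis unfolding P_def
        by (intro bexI[of _ "\<lambda>y. 2 * max (u y) (u z0) + 0 * u y + 0"] bexI[of _ "\<lambda>y. 1 * u y + 0 * u y + u z0"]) auto
    qed
    ultimately show ?thesis using u(2) by blast
  qed
  then obtain V where V: "\<And>x. x \<in> K \<Longrightarrow> open (V x) \<and> x \<in> V x \<and> P (V x)" by metis
  then obtain C where C: "C \<subseteq> K" "finite C" "K \<subseteq> (\<Union>x\<in>C. V x)"
    using compactE_image[OF K, of K V] by (metis (no_types, lifting) UN_iff subsetI)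
  have "P (\<Union>x\<in>C. V x)" using C(2,1)
  proof (induction rule: finite_induct)
    case (insert x F)
    then show ?case using union V by auto
  qed (simp add: empty)
  then show ?thesis unfolding P_def using C(3) by (meson subsetD)
qed

definition level_class :: "'a \<Rightarrow> 'a set" where
  "level_class z0 = {x. \<forall>u\<in>PSH_cb. u x = u z0}"

text \<open>
  The heart of the proof: if \<open>\<rho>\<close> had a local maximum on the class at \<open>z0\<close>, then \<open>\<rho>\<close> plus a mollified
  function of \<open>PSH_cb\<close> could be glued into a function of \<open>PSH_cb\<close> that is smooth and strictly
  plurisubharmonic near \<open>z0\<close>.
\<close>
lemma level_class_not_locally_maximal:
  assumes z0: "z0 \<in> core" and V: "open V" "z0 \<in> V" "smooth_strictly_plurisubharmonic_on V \<rho>"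
  shows "\<exists>z\<in>level_class z0 \<inter> V. \<rho> z > \<rho> z0"
proof (rule ccontr)
  assume "\<not> ?thesis"
  then have max: "\<rho> z \<le> \<rho> z0" if "z \<in> level_class z0" "z \<in> V" for z using that by force
  obtain U \<phi> where c: "(U, \<phi>) \<in> atlas" "z0 \<in> U" by (rule chart_at)
  let ?c = "\<phi> z0" and ?T = "\<phi> ` (U \<inter> V)" and ?f = "\<rho> \<circ> inv_into U \<phi>"
  let ?Q = "\<lambda>z. (z - ?c) \<bullet> (z - ?c)"
  have inv: "inv_into U \<phi> (\<phi> x) = x" if "x \<in> U" for x using chartD(6)[OF c(1) that] .
  have T: "open ?T" "?c \<in> ?T" using chart_image_open[OF c(1) V(1)] c V by auto
  obtain R0 \<delta> where R0: "R0 > 0" "\<delta> > 0" "cball ?c R0 \<subseteq> ?T"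
    and f\<delta>: "smooth_strictly_psh_on (ball ?c R0) (\<lambda>z. ?f z + (- \<delta>) * ?Q z)"
    using strictly_psh_perturb[OF T strictly_psh_in_chart[OF V(3) c(1)]] by blast
  define R where "R = R0 / 2"
  define r where "r = R / 2"
  \<comment> \<open>On the annulus the quadratic term lowers \<open>\<rho>\<close> by at least \<open>4 s\<close>. Of this, \<open>2 s\<close> bounds \<open>\<psi>\<close> off the
    set \<open>C\<close>, \<open>s\<close> lets \<open>\<rho>\<close> win at \<open>z0\<close>, and \<open>s / 2\<close> absorbs the error of the mollification.\<close>
  define s where "s = \<delta> * r\<^sup>2 / 4"
  have R: "0 < R" "R < R0" "0 < r" "r < R" using R0 by (auto simp: R_def r_def)
  have s: "s > 0" using R0 R by (simp add: s_def)
  have TU: "?T \<subseteq> \<phi> ` U" by auto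
  have sub: "cball ?c R \<subseteq> ?T" using R0(3) R subset_cball[of R R0 ?c] by auto
  have inV: "x \<in> V" if "x \<in> U" "\<phi> x \<in> cball ?c R" for x
  proof -
    have "\<phi> x \<in> ?T" using that sub by blast
    then show ?thesis using that(1) chartD(5)[OF c(1)] by (auto dest: inj_onD)
  qed
  define \<psi> where "\<psi> z = ?f z + (- \<delta>) * ?Q z - \<rho> z0" for z
  define C where "C = {z \<in> cball ?c R - ball ?c r. \<psi> z \<ge> - 2 * s}"
  define A where "A = U \<inter> \<phi> -` C"
  have \<psi>c: "continuous_on (cball ?c R) \<psi>"
  proof -
    have "continuous_on (ball ?c R0) (\<lambda>z. ?f z + (- \<delta>) * ?Q z)"
      using f\<delta> smooth_continuous unfolding smooth_strictly_psh_on_def by blast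
    moreover have "cball ?c R \<subseteq> ball ?c R0" using R by auto
    ultimately have "continuous_on (cball ?c R) (\<lambda>z. ?f z + (- \<delta>) * ?Q z)" by (rule continuous_on_subset)
    then show ?thesis unfolding \<psi>_def by (intro continuous_on_diff continuous_on_const)
  qed
  have "compact C"
  proof -
    have "continuous_on (cball ?c R - ball ?c r) \<psi>" by (rule continuous_on_subset[OF \<psi>c]) auto
    moreover have "compact (cball ?c R - ball ?c r)" by (intro compact_diff) auto
    ultimately have "closed ((cball ?c R - ball ?c r) \<inter> \<psi> -` {- 2 * s..})"
      using continuous_closed_preimage[OF _ compact_imp_closed closed_atLeast] by blast
    moreover have "C = (cball ?c R - ball ?c r) \<inter> \<psi> -` {- 2 * s..}" by (auto simp: C_def)
    moreover have "bounded C" by (rule bounded_subset[OF bounded_cball[of ?c R]]) (auto simp: C_def)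
    ultimately show ?thesis by (simp add: compact_eq_bounded_closed)
  qed
  moreover have "C \<subseteq> \<phi> ` U" using sub TU by (auto simp: C_def)
  ultimately have A: "compact A" unfolding A_def by (intro chart_preimage_compact[OF c(1)])
  have Qr: "4 * s \<le> \<delta> * ?Q z" if "z \<notin> ball ?c r" for z
  proof -
    have "r \<le> norm (z - ?c)" using that by (simp add: dist_norm norm_minus_commute)
    then have "r\<^sup>2 \<le> ?Q z" unfolding dot_square_norm using R by (intro power_mono) auto
    then show ?thesis using R0(2) by (simp add: s_def)
  qed
  have "\<exists>u\<in>PSH_cb. u x \<noteq> u z0" if x: "x \<in> A" for x
  proof (rule ccontr)
    assume "\<not> ?thesis"
    then have "x \<in> level_class z0" by (auto simp: level_class_def)
    moreover have "x \<in> V" using x inV by (auto simp: A_def C_def)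
    ultimately have "\<rho> x \<le> \<rho> z0" by (rule max)
    moreover have "4 * s \<le> \<delta> * ?Q (\<phi> x)" "\<psi> (\<phi> x) \<ge> - 2 * s" using x Qr by (auto simp: A_def C_def)
    moreover have "?f (\<phi> x) = \<rho> x" using x inv by (auto simp: A_def)
    ultimately show False using s unfolding \<psi>_def by simp
  qed
  from separating_difference[OF A this] obtain a b where ab: "a \<in> PSH_cb" "b \<in> PSH_cb" "a z0 = b z0"
    "\<forall>x. b x \<le> a x" "\<forall>x\<in>A. b x < a x" by blast
  have \<phi>A: "continuous_on A (\<lambda>x. \<psi> (\<phi> x))"
  proof (rule continuous_on_compose2[OF \<psi>c])
    show "continuous_on A \<phi>" by (rule continuous_on_subset[OF chartD(3)[OF c(1)]]) (auto simp: A_def)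
  qed (auto simp: A_def C_def)
  have "continuous_on A (\<lambda>x. (\<psi> (\<phi> x) + 2 * s) / (a x - b x))"
    by (intro continuous_on_divide continuous_on_add \<phi>A continuous_on_const continuous_on_diff PSH_cbD(1) ab)
      (use ab(5) in force)
  then have "bounded ((\<lambda>x. (\<psi> (\<phi> x) + 2 * s) / (a x - b x)) ` A)"
    by (intro compact_imp_bounded compact_continuous_image A)
  then obtain M where M: "\<And>x. x \<in> A \<Longrightarrow> \<bar>(\<psi> (\<phi> x) + 2 * s) / (a x - b x)\<bar> \<le> M"
    unfolding bounded_iff by auto
  define L where "L = max M 0"
  have L: "L \<ge> 0" by (simp add: L_def)
  \<comment> \<open>On \<open>A\<close> because of the choice of \<open>L\<close>, elsewhere on the annulus because the left-hand side is negative.\<close>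
  have dom: "\<psi> (\<phi> x) + 2 * s \<le> L * (a x - b x)" if x: "x \<in> U" "\<phi> x \<in> cball ?c R - ball ?c r" for x
  proof (cases "x \<in> A")
    case True
    then have "(\<psi> (\<phi> x) + 2 * s) / (a x - b x) \<le> L" using abs_le_D1[OF M] unfolding L_def by fastforce
    then show ?thesis using ab(5) True by (simp add: pos_divide_le_eq)
  next
    case False
    then have "\<psi> (\<phi> x) < - 2 * s" using x by (auto simp: A_def C_def)
    moreover have "L * (a x - b x) \<ge> 0" using L ab(4) by simp
    ultimately show ?thesis by linarith
  qed
  have La: "(\<lambda>x. L * a x + 0 * a x + (- s)) \<in> PSH_cb" by (rule PSH_cb_combine) (use ab L in auto)
  have Lb: "(\<lambda>x. L * b x + 0 * b x + 0) \<in> PSH_cb" by (rule PSH_cb_combine) (use ab L in auto)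
  obtain g where g: "smooth_on UNIV g" "\<And>z v. z \<in> ball ?c R \<Longrightarrow> line_lap g z v \<ge> 0"
    and g_near: "\<And>z. z \<in> cball ?c R \<Longrightarrow> \<bar>g z - ((\<lambda>x. L * b x + 0 * b x + 0) \<circ> inv_into U \<phi>) z\<bar> < s / 2"
  proof (rule psh_mollification[OF PSH_cbD(4)[OF Lb c(1)] PSH_cbD(3)[OF Lb c(1)], of ?c R0 R "s / 2"])
    show "cball ?c R0 \<subseteq> \<phi> ` U" using R0(3) TU by blast
  qed (use R s in auto)
  have g_near': "\<bar>g (\<phi> x) - L * b x\<bar> < s / 2" if "x \<in> U" "\<phi> x \<in> cball ?c R" for x
    using g_near[OF that(2)] inv[OF that(1)] by simp
  define \<Omega> where "\<Omega> = U \<inter> \<phi> -` ball ?c R"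
  define K where "K = U \<inter> \<phi> -` cball ?c r"
  define B where "B x = \<psi> (\<phi> x) + g (\<phi> x)" for x
  have \<Omega>: "open \<Omega>" "\<Omega> \<subseteq> U" unfolding \<Omega>_def using chart_preimage_open[OF c(1)] by auto
  have K: "compact K" unfolding K_def
    by (rule chart_preimage_compact[OF c(1) compact_cball]) (use sub TU R subset_cball[of r R ?c] in auto)
  have K\<Omega>: "K \<subseteq> \<Omega>" using R by (auto simp: K_def \<Omega>_def)
  have \<psi>g: "smooth_strictly_psh_on (ball ?c R) (\<lambda>z. \<psi> z + g z)"
  proof -
    have "smooth_strictly_psh_on (ball ?c R) (\<lambda>z. ?f z + (- \<delta>) * ?Q z)"
      by (rule smooth_strictly_psh_on_subset[OF f\<delta>]) (use R in auto)
    from smooth_strictly_psh_on_add[OF open_ball this smooth_const, of "- \<rho> z0"]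
    have "smooth_strictly_psh_on (ball ?c R) \<psi>" by (simp add: line_lap_const \<psi>_def[abs_def])
    from smooth_strictly_psh_on_add[OF open_ball this smooth_on_subset[OF g(1) subset_UNIV] g(2)]
    show ?thesis by simp
  qed
  have B: "smooth_strictly_plurisubharmonic_on \<Omega> B"
    by (rule strictly_psh_of_chart[OF c(1) \<Omega> smooth_strictly_psh_on_subset[OF \<psi>g]])
      (auto simp: \<Omega>_def B_def)
  have le: "B x \<le> L * a x + 0 * a x + (- s)" if "x \<in> \<Omega>" "x \<notin> K" for x
  proof -
    have x: "x \<in> U" "\<phi> x \<in> cball ?c R - ball ?c r" using that by (auto simp: \<Omega>_def K_def)
    have "\<bar>g (\<phi> x) - L * b x\<bar> < s / 2" using g_near' x by auto
    moreover have "\<psi> (\<phi> x) + 2 * s \<le> L * a x - L * b x"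
      using dom[OF x] by (simp add: right_diff_distrib)
    ultimately show ?thesis using s unfolding B_def by linarith
  qed
  have F: "(\<lambda>x. if x \<in> \<Omega> then max (L * a x + 0 * a x + (- s)) (B x) else L * a x + 0 * a x + (- s)) \<in> PSH_cb"
    (is "?F \<in> _")
    by (rule PSH_cb_glue[OF La \<Omega>(1) B K K\<Omega> le])
  define W where "W = {x \<in> \<Omega>. L * a x + 0 * a x + (- s) < B x}"
  have "open W"
  proof -
    have "continuous_on \<Omega> (\<lambda>x. B x - (L * a x + 0 * a x + (- s)))"
      by (intro continuous_on_diff strictly_psh_continuous[OF B \<Omega>(1)] PSH_cbD(1)[OF La])
    from continuous_open_preimage[OF this \<Omega>(1) open_greaterThan[of 0]]
    show ?thesis by (simp add: W_def vimage_def Int_def)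
  qed
  moreover have "z0 \<in> W"
  proof -
    have "z0 \<in> \<Omega>" using c(2) R by (simp add: \<Omega>_def)
    moreover have "\<psi> ?c = 0" using inv[OF c(2)] by (simp add: \<psi>_def)
    moreover have "\<bar>g ?c - L * b z0\<bar> < s / 2" using g_near' c(2) R by simp
    moreover have "L * a z0 = L * b z0" using ab(3) by simp
    ultimately have "L * a z0 + 0 * a z0 + (- s) < B z0" using s unfolding B_def by linarith
    with \<open>z0 \<in> \<Omega>\<close> show ?thesis by (simp add: W_def)
  qed
  moreover have "smooth_strictly_plurisubharmonic_on W ?F"
  proof (rule strictly_psh_of_chart[OF c(1) \<open>open W\<close>])
    show "W \<subseteq> U" using \<Omega>(2) by (auto simp: W_def)
    show "smooth_strictly_psh_on (\<phi> ` W) (\<lambda>z. \<psi> z + g z)"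
      by (rule smooth_strictly_psh_on_subset[OF \<psi>g]) (auto simp: W_def \<Omega>_def)
    show "?F x = \<psi> (\<phi> x) + g (\<phi> x)" if "x \<in> W" for x
      using that by (simp add: W_def B_def)
  qed
  ultimately have "z0 \<notin> core" using F unfolding core_def by blast
  with z0 show False by blast
qed

lemma strictly_psh_subset:
  assumes "smooth_strictly_plurisubharmonic_on W u" "W' \<subseteq> W"
  shows "smooth_strictly_plurisubharmonic_on W' u"
  unfolding smooth_strictly_plurisubharmonic_on_def
proof safe
  fix U \<phi> assume "(U, \<phi>) \<in> atlas"
  from strictly_psh_in_chart[OF assms(1) this]
  show "smooth_strictly_psh_on (\<phi> ` (U \<inter> W')) (u \<circ> inv_into U \<phi>)"
    by (rule smooth_strictly_psh_on_subset) (use assms(2) in auto)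
qed

lemma level_class_subset_core:
  assumes "z0 \<in> core" shows "level_class z0 \<subseteq> core"
proof
  fix x assume x: "x \<in> level_class z0"
  then show "x \<in> core" using not_core_separated[of x z0] assms unfolding level_class_def by fastforce
qed

lemma level_class_eq: "x \<in> level_class z0 \<Longrightarrow> level_class x = level_class z0"
  unfolding level_class_def by auto

lemma level_class_pseudoconcave:
  assumes "z0 \<in> core" shows "pseudoconcave1 (level_class z0)"
  unfolding pseudoconcave1_def
proof (intro conjI ballI allI impI)
  have "level_class z0 = (\<Inter>u\<in>PSH_cb. {x. u x = u z0})" by (auto simp: level_class_def)
  moreover have "closed (\<Inter>u\<in>PSH_cb. {x. u x = u z0})"
    by (intro closed_INT ballI closed_Collect_eq PSH_cbD(1) continuous_on_const)
  ultimately show "closed (level_class z0)" by simp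
next
  fix z1 V \<rho> U
  assume z1: "z1 \<in> level_class z0"
    and "open V \<and> z1 \<in> V \<and> smooth_strictly_plurisubharmonic_on V \<rho> \<and>
        open U \<and> z1 \<in> U \<and> compact (closure U) \<and> closure U \<subseteq> V"
  then have U: "open U" "z1 \<in> U" "smooth_strictly_plurisubharmonic_on U \<rho>"
    using strictly_psh_subset closure_subset by (blast, blast, meson order_trans)
  have "z1 \<in> core" using z1 level_class_subset_core[OF assms] by blast
  from level_class_not_locally_maximal[OF this U]
  show "\<exists>z\<in>level_class z0 \<inter> U. \<rho> z1 < \<rho> z" unfolding level_class_eq[OF z1] .
qed

lemma core_partition: "partition_on core (level_class ` core)"
proof (rule partition_onI)
  have self: "z \<in> level_class z" for z by (simp add: level_class_def)
  show "\<Union> (level_class ` core) = core"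
    using level_class_subset_core self by blast
  show "disjnt E E'" if "E \<in> level_class ` core" "E' \<in> level_class ` core" "E \<noteq> E'" for E E'
    using that level_class_eq by (metis (no_types) disjnt_iff imageE)
  show "{} \<notin> level_class ` core" using self by blast
qed

end

theorem mainTheorem2:
  fixes atlas :: "('a::{t2_space, second_countable_topology}, 'n::finite) chart set"
  assumes "complex_manifold atlas"
  shows "\<exists>\<E>. partition_on (complex_manifold.core atlas) \<E> \<and>
              (\<forall>E\<in>\<E>. complex_manifold.pseudoconcave1 atlas E) \<and>
              (\<forall>E\<in>\<E>. \<forall>u\<in>complex_manifold.PSH_cb atlas. u constant_on E)"
proof -
  interpret complex_manifold atlas by (rule assms)
  show ?thesis
  proof (intro exI conjI)
    show "partition_on core (level_class ` core)" by (rule core_partition)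
    show "\<forall>E\<in>level_class ` core. pseudoconcave1 E" using level_class_pseudoconcave by blast
    show "\<forall>E\<in>level_class ` core. \<forall>u\<in>PSH_cb. u constant_on E"
      by (auto simp: constant_on_def level_class_def)
  qed
qed

end
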